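(* Let $R$ be a subsuperring of a superring $S$ and let $v$ be a valuation on $R$. Suppose that $S$ is integral over $R$. If $w$ is a valuation on $S$ such that the pair $(A_w,\mathfrak p_w)$ dominates $(A_v,\mathfrak p_v)$, then $w$ extends $v$ to $S$. In particular, if $S$ is integral over $R$ (i.e. $\mathrm{cl}_S(R)=S$), then every valuation $v$ on $R$ has extensions to $S$.
   Context: A superring is a $\mathbb Z/2$-graded unital ring $R=R_{\overline 0}\oplus R_{\overline 1}$ with $1\neq 0$, assumed supercommutative: $R_{\overline 0}$ is central in $R$ and every element of $R_{\overline 1}$ squares to zero. A subsuperring $R\subseteq S$ is a subring with the same unit and compatible grading ($R_i=R\cap S_i$). A valuation on $R$ is a surjective map $v:R\to\mathbb G\cup\{\infty\}$, where $(\mathbb G,+,0)$ is a totally ordered abelian group (order invariant under translation) and $\infty$ is a symbol with $\infty>\alpha$ for $\alpha\in\mathbb G$ and $\infty+\alpha=\alpha+\infty=\infty+\infty=\infty$, such that $v(0)=\infty$, $v(1)=0$, $v(xy)=v(x)+v(y)$ and $v(x+y)\ge\min\{v(x),v(y)\}$ for all $x,y\in R$. Put $A_v=\{x\in R\mid v(x)\ge 0\}$ and $\mathfrak p_v=\{x\in R\mid v(x)>0\}$. The pair $(A_w,\mathfrak p_w)$ dominates $(A_v,\mathfrak p_v)$, written $(A_v,\mathfrak p_v)\preceq(A_w,\mathfrak p_w)$, if $A_v\subseteq A_w$ and $\mathfrak p_v=A_v\cap\mathfrak p_w$. A valuation $w:S\to\mathbb H\cup\{\infty\}$ is an extension of $v:R\to\mathbb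 G\cup\{\infty\}$ to $S$ (or extends $v$ to $S$) if there is an order isomorphism (order-preserving group isomorphism) $h:\mathbb G\to\mathbb J$ onto an ordered subgroup $\mathbb J\subseteq\mathbb H$, extended by $h(\infty)=\infty$, such that $w(x)=h(v(x))$ for all $x\in R$. A homogeneous $x\in S$ is integral over $R$ if there is a finitely generated $R$-supermodule $M=Rx_1+\cdots+Rx_n\subseteq S$ with $1\in M$, where $x_1,\dots,x_n$ are even elements in the center of $S$, such that $xM\subseteq M$. An arbitrary $x\in S$ is integral over $R$ if its homogeneous components are. $\mathrm{cl}_S(R)$ is the set of elements of $S$ integral over $R$; $S$ is integral over $R$ if every element of $S$ is. *)

theory Defs
  imports "HOL-Algebra.Subrings" "HOL-Algebra.AbelCoset"
begin

section \<open>Superrings\<close>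

record 'a superring = "'a ring" +
  even_part :: "'a set"
  odd_part :: "'a set"

locale superring = ring R for R :: "'a superring" (structure) +
  assumes one_neq_zero: "\<one> \<noteq> \<zero>"
    and even_subgroup: "additive_subgroup (even_part R) R"
    and odd_subgroup: "additive_subgroup (odd_part R) R"
    and grading_sum: "even_part R <+> odd_part R = carrier R"
    and grading_direct: "even_part R \<inter> odd_part R = {\<zero>}"
    and even_even: "\<lbrakk>x \<in> even_part R; y \<in> even_part R\<rbrakk> \<Longrightarrow> x \<otimes> y \<in> even_part R"
    and even_odd: "\<lbrakk>x \<in> even_part R; y \<in> odd_part R\<rbrakk> \<Longrightarrow> x \<otimes> y \<in> odd_part R"
    and odd_even: "\<lbrakk>x \<in> odd_part R; y \<in> even_part R\<rbrakk> \<Longrightarrow> x \<otimes> y \<in> odd_part R"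
    and odd_odd: "\<lbrakk>x \<in> odd_part R; y \<in> odd_part R\<rbrakk> \<Longrightarrow> x \<otimes> y \<in> even_part R"
    and even_central: "\<lbrakk>x \<in> even_part R; y \<in> carrier R\<rbrakk> \<Longrightarrow> x \<otimes> y = y \<otimes> x"
    and odd_square: "x \<in> odd_part R \<Longrightarrow> x \<otimes> x = \<zero>"

definition restrict_superring :: "'a superring \<Rightarrow> 'a set \<Rightarrow> 'a superring" where
  "restrict_superring S R =
     S\<lparr>carrier := R, even_part := R \<inter> even_part S, odd_part := R \<inter> odd_part S\<rparr>"

text \<open>The second conjunct is a real condition: \<open>R\<close> has to contain the homogeneous
  components of its elements.\<close>

definition subsuperring :: "'a set \<Rightarrow> 'a superring \<Rightarrow> bool" where
  "subsuperring R S \<longleftrightarrow> subring R S \<and> superring (restrict_superring S R)"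


section \<open>Totally ordered abelian groups and valuations\<close>

text \<open>The group law, additive in the usual notation for valuations, is written
  multiplicatively, following the library's \<^locale>\<open>comm_group\<close>. Ordered groups are records
  and not instances of a type class, so that one can quantify existentially over them.
  Such a quantifier ranges over groups on a fixed type. For value groups of valuations on a ring
  over \<open>'a\<close> the type \<open>'a set\<close> is large enough: valuations are surjective, so mapping \<open>\<gamma>\<close>
  to its fibre transports every value group to a group of subsets of the ring.\<close>

record 'g ordered_group = "'g monoid" +
  ord_rel :: "('g \<times> 'g) set"

locale ordered_abelian_group = comm_group G for G :: "'g ordered_group" (structure) +
  assumes linear_order: "linear_order_on (carrier G) (ord_rel G)"
    and translation: "\<lbrakk>(x, y) \<in> ord_rel G; z \<in> carrier G\<rbrakk> \<Longrightarrow> (x \<otimes> z, y \<otimes> z) \<in> ord_rel G"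

text \<open>\<open>G \<union> {\<infinity>}\<close> is encoded by \<open>option\<close>, with \<^term>\<open>None\<close> as \<open>\<infinity>\<close>, the largest element.\<close>

fun val_le :: "'g ordered_group \<Rightarrow> 'g option \<Rightarrow> 'g option \<Rightarrow> bool" where
  "val_le G a None = True"
| "val_le G None (Some y) = False"
| "val_le G (Some x) (Some y) = ((x, y) \<in> ord_rel G)"

definition val_less :: "'g ordered_group \<Rightarrow> 'g option \<Rightarrow> 'g option \<Rightarrow> bool" where
  "val_less G a b \<longleftrightarrow> val_le G a b \<and> a \<noteq> b"

fun val_add :: "'g ordered_group \<Rightarrow> 'g option \<Rightarrow> 'g option \<Rightarrow> 'g option" where
  "val_add G (Some x) (Some y) = Some (x \<otimes>\<^bsub>G\<^esub> y)"
| "val_add G None b = None"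
| "val_add G a None = None"

definition val_min :: "'g ordered_group \<Rightarrow> 'g option \<Rightarrow> 'g option \<Rightarrow> 'g option" where
  "val_min G a b = (if val_le G a b then a else b)"

definition val_zero :: "'g ordered_group \<Rightarrow> 'g option" where
  "val_zero G = Some \<one>\<^bsub>G\<^esub>"

locale valuation = superring R + value_group: ordered_abelian_group G
  for R :: "'a superring" (structure) and G :: "'g ordered_group" and v :: "'a \<Rightarrow> 'g option" +
  assumes surjective: "v ` carrier R = insert None (Some ` carrier G)"
    and val_of_zero: "v \<zero> = None"
    and val_of_one: "v \<one> = val_zero G"
    and val_of_mult: "\<lbrakk>x \<in> carrier R; y \<in> carrier R\<rbrakk> \<Longrightarrow> v (x \<otimes> y) = val_add G (v x) (v y)"
    and val_of_add: "\<lbrakk>x \<in> carrier R; y \<in> carrier R\<rbrakk> \<Longrightarrow>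
      val_le G (val_min G (v x) (v y)) (v (x \<oplus> y))"

definition val_ring :: "'a superring \<Rightarrow> 'g ordered_group \<Rightarrow> ('a \<Rightarrow> 'g option) \<Rightarrow> 'a set" where
  "val_ring R G v = {x \<in> carrier R. val_le G (val_zero G) (v x)}"

definition val_ideal :: "'a superring \<Rightarrow> 'g ordered_group \<Rightarrow> ('a \<Rightarrow> 'g option) \<Rightarrow> 'a set" where
  "val_ideal R G v = {x \<in> carrier R. val_less G (val_zero G) (v x)}"

definition dominates :: "'a set \<times> 'a set \<Rightarrow> 'a set \<times> 'a set \<Rightarrow> bool" where
  "dominates B A \<longleftrightarrow> fst A \<subseteq> fst B \<and> snd A = fst A \<inter> snd B"

definition order_iso_onto ::
  "'g ordered_group \<Rightarrow> 'h ordered_group \<Rightarrow> 'h set \<Rightarrow> ('g \<Rightarrow> 'h) \<Rightarrow> bool" where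
  "order_iso_onto G H J h \<longleftrightarrow> subgroup J H \<and> h \<in> iso G (H\<lparr>carrier := J\<rparr>) \<and>
     (\<forall>x\<in>carrier G. \<forall>y\<in>carrier G. (x, y) \<in> ord_rel G \<longleftrightarrow> (h x, h y) \<in> ord_rel H)"

definition extends_valuation ::
  "'a superring \<Rightarrow> 'h ordered_group \<Rightarrow> ('a \<Rightarrow> 'h option) \<Rightarrow>
   'a set \<Rightarrow> 'g ordered_group \<Rightarrow> ('a \<Rightarrow> 'g option) \<Rightarrow> bool" where
  "extends_valuation S H w R G v \<longleftrightarrow>
     valuation S H w \<and> valuation (restrict_superring S R) G v \<and>
     (\<exists>J h. order_iso_onto G H J h \<and> (\<forall>x\<in>R. w x = map_option h (v x)))"


section \<open>Integrality\<close>

text \<open>Since the \<open>xs i\<close> below are even and \<open>R\<close> contains the homogeneous components of its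
  elements, the span of the \<open>xs i\<close> is automatically graded.\<close>

definition span_over :: "'a superring \<Rightarrow> 'a set \<Rightarrow> nat \<Rightarrow> (nat \<Rightarrow> 'a) \<Rightarrow> 'a set" where
  "span_over S R n xs = {\<Oplus>\<^bsub>S\<^esub>i\<in>{1..n}. r i \<otimes>\<^bsub>S\<^esub> xs i | r. r \<in> {1..n} \<rightarrow> R}"

definition ring_center :: "'a superring \<Rightarrow> 'a set" where
  "ring_center S = {z \<in> carrier S. \<forall>y\<in>carrier S. z \<otimes>\<^bsub>S\<^esub> y = y \<otimes>\<^bsub>S\<^esub> z}"

definition homogeneous_integral :: "'a superring \<Rightarrow> 'a set \<Rightarrow> 'a \<Rightarrow> bool" where
  "homogeneous_integral S R x \<longleftrightarrow> x \<in> even_part S \<union> odd_part S \<and>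
     (\<exists>n xs. (\<forall>i\<in>{1..n}. xs i \<in> even_part S \<inter> ring_center S) \<and>
       \<one>\<^bsub>S\<^esub> \<in> span_over S R n xs \<and>
       (\<forall>m\<in>span_over S R n xs. x \<otimes>\<^bsub>S\<^esub> m \<in> span_over S R n xs))"

definition integral_closure :: "'a superring \<Rightarrow> 'a set \<Rightarrow> 'a set" where
  "integral_closure S R = {x0 \<oplus>\<^bsub>S\<^esub> x1 | x0 x1. x0 \<in> even_part S \<and> x1 \<in> odd_part S \<and>
     homogeneous_integral S R x0 \<and> homogeneous_integral S R x1}"

definition integral_over :: "'a superring \<Rightarrow> 'a set \<Rightarrow> bool" where
  "integral_over S R \<longleftrightarrow> integral_closure S R = carrier S"

end

theory Submission
  imports Defs
begin

text \<open>Up to an order isomorphism of its value group, a valuation \<open>w\<close> is determined by the relation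
\<open>w x \<le> w y\<close> between ring elements. Both halves of the proof work with this relation: a valuation on \<open>S\<close>
extends \<open>v\<close> if it compares the elements of \<open>R\<close> as \<open>v\<close> does, and a valuation is constructed by
saying how it compares elements.

\<^bold>\<open>A dominating valuation extends.\<close> Let \<open>w\<close> on \<open>S\<close> dominate \<open>v\<close> on \<open>R\<close>. If \<open>x\<close> in \<open>R\<close> has
finite value, surjectivity of \<open>v\<close> gives \<open>z\<close> in \<open>R\<close> with \<open>v (x z) = 0\<close>, and domination transfers the
equation to \<open>w\<close>; multiplying by such elements reduces every comparison of two values to a comparison
with \<open>0\<close>, where \<open>v\<close> and \<open>w\<close> agree. The elements of infinite value are where integrality
enters. If \<open>v x = \<infinity>\<close>, then \<open>x r\<close> is in \<open>A\<^sub>v\<close> for all \<open>r\<close> in \<open>R\<close>, so the values \<open>w r\<close> are bounded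
below by \<open>- w x\<close>. By integrality every \<open>w s\<close> with \<open>s\<close> in \<open>S\<close> lies above
some \<open>w r\<close> (\<open>integral_bound\<close>), so all of \<open>w\<close> would be bounded below by \<open>- w x < 0\<close>, which contradicts
surjectivity unless \<open>w x = \<infinity>\<close>. The lower bound \<open>w r\<close> needs no characteristic polynomial: if \<open>s\<close>
maps the span of \<open>x\<^sub>1, ..., x\<^sub>n\<close> into itself and \<open>x\<^sub>i\<close> is a generator of least value, then
\<open>s x\<^sub>i = r\<^sub>1 x\<^sub>1 + ... + r\<^sub>n x\<^sub>n\<close> has at least the value of some summand \<open>r\<^sub>j x\<^sub>j\<close>, hence at least that
of \<open>r\<^sub>j x\<^sub>i\<close>, and \<open>x\<^sub>i\<close> can be cancelled.

\<^bold>\<open>A dominating valuation exists.\<close> Odd elements have square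
zero, hence infinite value, so valuations live on the commutative ring of even elements. There Manis'
theorem applies: Zorn's lemma yields a subring \<open>B\<close> with a prime ideal \<open>q\<close> that
dominates the pair of \<open>v\<close> and is maximal, and maximality forces every \<open>x\<close> outside
\<open>B\<close> to have a multiple \<open>x y\<close> with \<open>y\<close> in \<open>q\<close> and \<open>x y\<close> in \<open>B - q\<close> (\<open>manis_property\<close>). Such a pair
is the pair of a valuation, whose values are the sets \<open>{z. x z \<in> q}\<close>
ordered by inclusion.\<close>

section \<open>Polynomial expressions in a ring element\<close>

text \<open>The elements \<open>a\<^sub>0 + a\<^sub>1 x + ... + a\<^sub>n x\<^sup>n\<close> with all coefficients in \<open>U\<close>. The recursion splits
off the leading term because that is the term which the reductions below replace. For a subring \<open>B\<close> with
ideal \<open>q\<close>, the unions over \<open>n\<close> are the ring \<open>B[x]\<close> and its ideal \<open>q B[x]\<close>.\<close>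

primrec poly_values :: "('a, 'b) ring_scheme \<Rightarrow> 'a set \<Rightarrow> 'a \<Rightarrow> nat \<Rightarrow> 'a set" where
  "poly_values R U x 0 = U"
| "poly_values R U x (Suc n) =
     {p \<oplus>\<^bsub>R\<^esub> a \<otimes>\<^bsub>R\<^esub> x [^]\<^bsub>R\<^esub> Suc n | p a. p \<in> poly_values R U x n \<and> a \<in> U}"

locale ring_submodule = cring +
  fixes B U
  assumes B_subring: "subring B R"
    and U_carrier: "U \<subseteq> carrier R"
    and U_zero: "\<zero> \<in> U"
    and U_add: "\<lbrakk>a \<in> U; b \<in> U\<rbrakk> \<Longrightarrow> a \<oplus> b \<in> U"
    and U_scale: "\<lbrakk>b \<in> B; a \<in> U\<rbrakk> \<Longrightarrow> b \<otimes> a \<in> U"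
begin

lemma B_carrier: "B \<subseteq> carrier R"
  using subringE(1)[OF B_subring] .

lemma poly_values_carrier:
  assumes "x \<in> carrier R" shows "poly_values R U x n \<subseteq> carrier R"
  using U_carrier assms by (induction n) auto

lemma poly_values_Suc_iff:
  "y \<in> poly_values R U x (Suc n) \<longleftrightarrow>
    (\<exists>p\<in>poly_values R U x n. \<exists>a\<in>U. y = p \<oplus> a \<otimes> x [^] Suc n)"
  by auto

lemma poly_values_mono:
  assumes x: "x \<in> carrier R" and "m \<le> n"
  shows "poly_values R U x m \<subseteq> poly_values R U x n"
  using \<open>m \<le> n\<close>
proof (induction n rule: dec_induct)
  case (step n)
  have "p \<in> poly_values R U x (Suc n)" if p: "p \<in> poly_values R U x n" for p
  proof -
    have "p = p \<oplus> \<zero> \<otimes> x [^] Suc n"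
      using p poly_values_carrier[OF x] x by (simp add: subset_iff del: nat_pow_Suc)
    then show ?thesis using p U_zero unfolding poly_values_Suc_iff by blast
  qed
  with step.IH show ?case by blast
qed simp

lemma poly_values_add:
  assumes x: "x \<in> carrier R"
  shows "\<lbrakk>p \<in> poly_values R U x n; p' \<in> poly_values R U x n\<rbrakk> \<Longrightarrow> p \<oplus> p' \<in> poly_values R U x n"
proof (induction n arbitrary: p p')
  case 0 then show ?case using U_add by simp
next
  case (Suc n)
  from Suc.prems obtain q a q' a' where
    q: "q \<in> poly_values R U x n" "a \<in> U" "p = q \<oplus> a \<otimes> x [^] Suc n" and
    q': "q' \<in> poly_values R U x n" "a' \<in> U" "p' = q' \<oplus> a' \<otimes> x [^] Suc n"
    unfolding poly_values_Suc_iff by blast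
  have c: "q \<in> carrier R" "q' \<in> carrier R" "a \<in> carrier R" "a' \<in> carrier R"
    "x [^] Suc n \<in> carrier R"
    using q q' U_carrier poly_values_carrier[OF x, of n] x by auto
  have "p \<oplus> p' = (q \<oplus> q') \<oplus> (a \<oplus> a') \<otimes> x [^] Suc n"
    unfolding q(3) q'(3) using c by (simp add: l_distr a_ac del: nat_pow_Suc)
  then show ?case
    using Suc.IH[OF q(1) q'(1)] U_add[OF q(2) q'(2)] unfolding poly_values_Suc_iff by blast
qed

lemma poly_values_scale:
  assumes x: "x \<in> carrier R" and b: "b \<in> B"
  shows "p \<in> poly_values R U x n \<Longrightarrow> b \<otimes> p \<in> poly_values R U x n"
proof (induction n arbitrary: p)
  case 0 then show ?case using U_scale b by simp
next
  case (Suc n)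
  from Suc.prems obtain q a where
    q: "q \<in> poly_values R U x n" "a \<in> U" "p = q \<oplus> a \<otimes> x [^] Suc n"
    unfolding poly_values_Suc_iff by blast
  have c: "q \<in> carrier R" "a \<in> carrier R" "b \<in> carrier R" "x [^] Suc n \<in> carrier R"
    using q b B_carrier U_carrier poly_values_carrier[OF x, of n] x by auto
  have "b \<otimes> p = b \<otimes> q \<oplus> (b \<otimes> a) \<otimes> x [^] Suc n"
    unfolding q(3) using c by (simp add: r_distr m_assoc del: nat_pow_Suc)
  then show ?case
    using Suc.IH[OF q(1)] U_scale[OF b q(2)] unfolding poly_values_Suc_iff by blast
qed

lemma poly_values_shift:
  assumes x: "x \<in> carrier R"
  shows "p \<in> poly_values R U x n \<Longrightarrow> x \<otimes> p \<in> poly_values R U x (Suc n)"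
proof (induction n arbitrary: p)
  case 0
  then have p: "p \<in> U" by simp
  then have "x \<otimes> p = \<zero> \<oplus> p \<otimes> x [^] Suc 0"
    using x U_carrier by (auto simp: m_comm)
  then show ?case using p U_zero unfolding poly_values_Suc_iff by auto
next
  case (Suc n)
  from Suc.prems obtain q a where
    q: "q \<in> poly_values R U x n" "a \<in> U" "p = q \<oplus> a \<otimes> x [^] Suc n"
    unfolding poly_values_Suc_iff by blast
  have c: "q \<in> carrier R" "a \<in> carrier R"
    using q U_carrier poly_values_carrier[OF x, of n] by auto
  have "x \<otimes> p = x \<otimes> q \<oplus> a \<otimes> x [^] Suc (Suc n)"
    unfolding q(3) using c x by (simp add: r_distr m_ac)
  then show ?case
    using Suc.IH[OF q(1)] q(2) unfolding poly_values_Suc_iff[of _ _ "Suc n"] by blast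
qed

lemma poly_values_shift_pow:
  assumes x: "x \<in> carrier R" and p: "p \<in> poly_values R U x n"
  shows "x [^] (k::nat) \<otimes> p \<in> poly_values R U x (n + k)"
proof (induction k)
  case 0 then show ?case using p poly_values_carrier[OF x, of n] by (simp add: subset_iff)
next
  case (Suc k)
  have "p \<in> carrier R" using p poly_values_carrier[OF x] by blast
  then have "x [^] Suc k \<otimes> p = x \<otimes> (x [^] k \<otimes> p)" using x by (simp add: m_ac)
  then show ?case using poly_values_shift[OF x Suc.IH] by simp
qed

lemma B_submodule: "ring_submodule R B B"
  by (intro ring_submodule.intro ring_submodule_axioms.intro cring_axioms B_subring B_carrier
      subringE(2,6,7)[OF B_subring])

lemma poly_values_mult:
  assumes x: "x \<in> carrier R" and p: "p \<in> poly_values R U x n"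
  shows "b \<in> poly_values R B x m \<Longrightarrow> b \<otimes> p \<in> poly_values R U x (n + m)"
proof (induction m arbitrary: b)
  case 0 then show ?case using poly_values_scale[OF x _ p] by simp
next
  case (Suc m)
  interpret B: ring_submodule R B B by (rule B_submodule)
  from Suc.prems obtain c a where
    c: "c \<in> poly_values R B x m" "a \<in> B" "b = c \<oplus> a \<otimes> x [^] Suc m"
    unfolding B.poly_values_Suc_iff by blast
  have car: "c \<in> carrier R" "a \<in> carrier R" "x [^] Suc m \<in> carrier R" "p \<in> carrier R"
    using c p B.U_carrier B.poly_values_carrier[OF x, of m] poly_values_carrier[OF x, of n] x by auto
  have "b \<otimes> p = c \<otimes> p \<oplus> a \<otimes> (x [^] Suc m \<otimes> p)"
    unfolding c(3) using car by (simp add: l_distr m_assoc del: nat_pow_Suc)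
  moreover have "c \<otimes> p \<in> poly_values R U x (n + Suc m)"
    using Suc.IH[OF c(1)] poly_values_mono[OF x, of "n + m" "n + Suc m"] by auto
  moreover have "a \<otimes> (x [^] Suc m \<otimes> p) \<in> poly_values R U x (n + Suc m)"
    using poly_values_scale[OF x c(2)] poly_values_shift_pow[OF x p, of "Suc m"] by blast
  ultimately show ?case by (simp only: poly_values_add[OF x])
qed

text \<open>Multiplication by \<open>a\<^sup>n\<close> turns \<open>c x\<^sup>i\<close> into \<open>c a\<^sup>n\<^sup>-\<^sup>i (a x)\<^sup>i\<close>. Applied to an equation for \<open>x\<close> with leading
coefficient \<open>a\<close>, it makes the equation monic in \<open>a x\<close>.\<close>

lemma poly_values_homogenize:
  assumes x: "x \<in> carrier R" and a: "a \<in> B"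
  shows "p \<in> poly_values R U x n \<Longrightarrow> a [^] n \<otimes> p \<in> poly_values R U (a \<otimes> x) n"
proof (induction n arbitrary: p)
  case 0 then show ?case using U_carrier by auto
next
  case (Suc n)
  from Suc.prems obtain q c where
    q: "q \<in> poly_values R U x n" "c \<in> U" "p = q \<oplus> c \<otimes> x [^] Suc n"
    unfolding poly_values_Suc_iff by blast
  have ac: "a \<in> carrier R" using a B_carrier by blast
  have car: "q \<in> carrier R" "c \<in> carrier R" "a [^] n \<in> carrier R" "a [^] Suc n \<in> carrier R"
     "x [^] Suc n \<in> carrier R"
    using q U_carrier poly_values_carrier[OF x, of n] ac x by auto
  have "a [^] Suc n \<otimes> p = a [^] Suc n \<otimes> q \<oplus> c \<otimes> (a [^] Suc n \<otimes> x [^] Suc n)"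
    unfolding q(3) using car by (simp add: r_distr m_ac del: nat_pow_Suc)
  also have "a [^] Suc n \<otimes> q = a \<otimes> (a [^] n \<otimes> q)"
    using car ac by (simp add: m_ac)
  also have "a [^] Suc n \<otimes> x [^] Suc n = (a \<otimes> x) [^] Suc n"
    using nat_pow_distrib[OF ac x, of "Suc n"] by (rule sym)
  finally show ?case
    using poly_values_scale[OF _ a Suc.IH[OF q(1)]] x ac q(2) unfolding poly_values_Suc_iff by blast
qed

end

lemma poly_values_subset:
  assumes "U \<subseteq> V" shows "poly_values R U x n \<subseteq> poly_values R V x n"
  using assms by (induction n) auto

section \<open>Existence of Manis pairs\<close>

text \<open>The pairs \<open>(A\<^sub>v, p\<^sub>v)\<close> of valuations \<open>v\<close> on a commutative ring are exactly these: the last axiom is what is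
left of the inverses that a field would provide.\<close>

locale manis_pair = cring +
  fixes B q
  assumes subring: "subring B R"
    and ideal_subset: "q \<subseteq> B"
    and ideal_zero: "\<zero> \<in> q"
    and ideal_add: "\<lbrakk>a \<in> q; b \<in> q\<rbrakk> \<Longrightarrow> a \<oplus> b \<in> q"
    and ideal_absorb: "\<lbrakk>b \<in> B; a \<in> q\<rbrakk> \<Longrightarrow> b \<otimes> a \<in> q"
    and one_notin: "\<one> \<notin> q"
    and prime: "\<lbrakk>a \<in> B; b \<in> B; a \<otimes> b \<in> q\<rbrakk> \<Longrightarrow> a \<in> q \<or> b \<in> q"
    and manis: "\<lbrakk>x \<in> carrier R; x \<notin> B\<rbrakk> \<Longrightarrow> \<exists>y\<in>q. x \<otimes> y \<in> B - q"

text \<open>The candidates for the ideal of the pair: non-unital subrings stable under \<open>A\<close>. The ring in which a candidate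
is an ideal is recovered from it as its idealizer, so that Zorn's lemma can be applied to single sets
ordered by inclusion instead of pairs.\<close>

definition (in cring) closed_over :: "'a set \<Rightarrow> 'a set \<Rightarrow> bool" where
  "closed_over A I \<longleftrightarrow> I \<subseteq> carrier R \<and> \<zero> \<in> I \<and> (\<forall>a\<in>I. \<forall>b\<in>I. a \<oplus> b \<in> I \<and> a \<otimes> b \<in> I) \<and>
     (\<forall>a\<in>A. \<forall>b\<in>I. a \<otimes> b \<in> I)"

locale maximal_avoiding = cring +
  fixes A T q
  assumes A_subring: "subring A R"
    and T_subset: "T \<subseteq> A"
    and T_one: "\<one> \<in> T"
    and T_mult: "\<lbrakk>s \<in> T; t \<in> T\<rbrakk> \<Longrightarrow> s \<otimes> t \<in> T"
    and q_closed: "closed_over A q"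
    and q_avoids: "q \<inter> T = {}"
    and q_maximal: "\<lbrakk>closed_over A J; q \<subseteq> J; J \<inter> T = {}\<rbrakk> \<Longrightarrow> J = q"
begin

definition idealizer :: "'a set" where
  "idealizer = {x \<in> carrier R. \<forall>a\<in>q. x \<otimes> a \<in> q}"

lemma q_carrier: "q \<subseteq> carrier R" and q_zero: "\<zero> \<in> q"
  and q_add: "\<lbrakk>a \<in> q; b \<in> q\<rbrakk> \<Longrightarrow> a \<oplus> b \<in> q"
  and q_mult: "\<lbrakk>a \<in> q; b \<in> q\<rbrakk> \<Longrightarrow> a \<otimes> b \<in> q"
  and q_scale: "\<lbrakk>a \<in> A; b \<in> q\<rbrakk> \<Longrightarrow> a \<otimes> b \<in> q"
  using q_closed unfolding closed_over_def by auto

lemma A_idealizer: "A \<subseteq> idealizer"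
  using q_scale subringE(1)[OF A_subring] unfolding idealizer_def by auto

lemma q_idealizer: "q \<subseteq> idealizer"
  using q_mult q_carrier unfolding idealizer_def by auto

lemma idealizerI: "\<lbrakk>x \<in> carrier R; \<And>a. a \<in> q \<Longrightarrow> x \<otimes> a \<in> q\<rbrakk> \<Longrightarrow> x \<in> idealizer"
  and idealizer_carrier: "x \<in> idealizer \<Longrightarrow> x \<in> carrier R"
  and idealizerD: "\<lbrakk>x \<in> idealizer; a \<in> q\<rbrakk> \<Longrightarrow> x \<otimes> a \<in> q"
  unfolding idealizer_def by auto

lemma subring_idealizer: "subring idealizer R"
proof (rule subringI)
  show "idealizer \<subseteq> carrier R" using idealizer_carrier by blast
  show "\<one> \<in> idealizer" using A_idealizer subringE(3)[OF A_subring] by blast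
  fix h assume h: "h \<in> idealizer"
  note hc = idealizer_carrier[OF h]
  show "\<ominus> h \<in> idealizer"
  proof (rule idealizerI)
    fix a assume a: "a \<in> q"
    have ac: "a \<in> carrier R" using a q_carrier by blast
    have "\<ominus> \<one> \<otimes> (h \<otimes> a) \<in> q"
      using idealizerD[OF h a] q_scale subringE(3,5)[OF A_subring] by simp
    then show "\<ominus> h \<otimes> a \<in> q" using ac hc by (simp add: l_minus)
  qed (use hc in simp)
  fix h' assume h': "h' \<in> idealizer"
  note hc' = idealizer_carrier[OF h']
  show "h \<otimes> h' \<in> idealizer"
  proof (rule idealizerI)
    fix a assume a: "a \<in> q"
    have "h \<otimes> (h' \<otimes> a) \<in> q" using idealizerD h h' a by blast
    then show "h \<otimes> h' \<otimes> a \<in> q" using a q_carrier hc hc' by (simp add: m_assoc subset_iff)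
  qed (use hc hc' in simp)
  show "h \<oplus> h' \<in> idealizer"
  proof (rule idealizerI)
    fix a assume a: "a \<in> q"
    have "h \<otimes> a \<oplus> h' \<otimes> a \<in> q" using idealizerD h h' a q_add by blast
    then show "(h \<oplus> h') \<otimes> a \<in> q" using a q_carrier hc hc' by (simp add: l_distr subset_iff)
  qed (use hc hc' in simp)
qed

sublocale S: ring_submodule R idealizer q
  by (intro ring_submodule.intro ring_submodule_axioms.intro cring_axioms subring_idealizer
      q_carrier q_zero q_add idealizerD)

sublocale SB: ring_submodule R idealizer idealizer
  by (rule S.B_submodule)

text \<open>Otherwise \<open>q B[x]\<close>, with \<open>B\<close> the idealizer, would be a candidate that contains \<open>q\<close> and avoids
\<open>T\<close>, hence equal to \<open>q\<close> by maximality.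
As \<open>x q\<close> is contained in it, \<open>x\<close> would idealize \<open>q\<close>.\<close>

lemma meets_outside:
  assumes x: "x \<in> carrier R" "x \<notin> idealizer"
  shows "\<exists>n. \<exists>t\<in>T. t \<in> poly_values R q x n"
proof (rule ccontr)
  assume contr: "\<not> ?thesis"
  define J where "J = (\<Union>n. poly_values R q x n)"
  have qJ: "q \<subseteq> J" unfolding J_def using poly_values.simps(1)[of R q x] by blast
  have "closed_over A J"
    unfolding closed_over_def
  proof (intro conjI ballI)
    show "J \<subseteq> carrier R" using S.poly_values_carrier[OF x(1)] unfolding J_def by blast
    show "\<zero> \<in> J" using qJ q_zero by blast
    fix a b assume "b \<in> J" 
    then obtain n where n: "b \<in> poly_values R q x n" unfolding J_def by blast
    { assume "a \<in> A"
      then show "a \<otimes> b \<in> J"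
        using A_idealizer S.poly_values_scale[OF x(1) _ n] unfolding J_def by blast }
    assume "a \<in> J"
    then obtain m where m: "a \<in> poly_values R q x m" unfolding J_def by blast
    have "a \<in> poly_values R q x (max m n)" "b \<in> poly_values R q x (max m n)"
      using m n S.poly_values_mono[OF x(1), of _ "max m n"] by (meson max.cobounded1 max.cobounded2 subsetD)+
    then show "a \<oplus> b \<in> J" using S.poly_values_add[OF x(1)] unfolding J_def by blast
    have "a \<in> poly_values R idealizer x m" using m poly_values_subset[OF q_idealizer] by blast
    then show "a \<otimes> b \<in> J" using S.poly_values_mult[OF x(1) n] unfolding J_def by blast
  qed
  then have "J = q" using q_maximal[OF _ qJ] contr unfolding J_def by blast
  moreover have "x \<otimes> a \<in> J" if "a \<in> q" for a
    using S.poly_values_shift[OF x(1), of a 0] that unfolding J_def by fastforce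
  ultimately show False using x by (auto simp: idealizer_def)
qed

text \<open>The ideal \<open>q + B a\<close> is a candidate strictly larger than \<open>q\<close>, so it cannot avoid \<open>T\<close>.\<close>

lemma meets_adjoin:
  assumes a: "a \<in> idealizer" "a \<notin> q"
  shows "\<exists>c\<in>q. \<exists>b\<in>idealizer. c \<oplus> b \<otimes> a \<in> T"
proof (rule ccontr)
  assume contr: "\<not> ?thesis"
  have ac: "a \<in> carrier R" using a by (auto simp: idealizer_def)
  note Bc = S.B_carrier
  define J where "J = {c \<oplus> b \<otimes> a | c b. c \<in> q \<and> b \<in> idealizer}"
  have JI: "c \<oplus> b \<otimes> a \<in> J" if "c \<in> q" "b \<in> idealizer" for c b using that unfolding J_def by blast
  note BE = subringE[OF subring_idealizer]
  have qJ: "q \<subseteq> J"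
  proof
    fix c assume c: "c \<in> q"
    then have "c = c \<oplus> \<zero> \<otimes> a" using q_carrier ac by (simp add: subset_iff)
    then show "c \<in> J" using JI[OF c BE(2)] by simp
  qed
  have "closed_over A J"
    unfolding closed_over_def
  proof (intro conjI ballI)
    show "J \<subseteq> carrier R" using q_carrier Bc ac unfolding J_def by auto
    show "\<zero> \<in> J" using qJ q_zero by blast
    fix x y assume "y \<in> J" 
    then obtain c b where y: "y = c \<oplus> b \<otimes> a" "c \<in> q" "b \<in> idealizer" unfolding J_def by blast
    then have yc: "c \<in> carrier R" "b \<in> carrier R" using q_carrier Bc by auto
    have yB: "y \<in> idealizer"
      unfolding y(1) using y(2,3) q_idealizer a(1) by (intro BE(6,7)) auto
    have scale: "z \<otimes> y \<in> J" if z: "z \<in> idealizer" for z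
    proof -
      have zc: "z \<in> carrier R" using z Bc by blast
      have "z \<otimes> y = z \<otimes> c \<oplus> (z \<otimes> b) \<otimes> a"
        unfolding y(1) using yc ac zc by (simp add: r_distr m_assoc)
      then show ?thesis using JI[OF S.U_scale[OF z y(2)] BE(6)[OF z y(3)]] by simp
    qed
    { assume "x \<in> A" then show "x \<otimes> y \<in> J" using scale A_idealizer by blast }
    assume "x \<in> J"
    then obtain c' b' where x: "x = c' \<oplus> b' \<otimes> a" "c' \<in> q" "b' \<in> idealizer" unfolding J_def by blast
    then have xc: "c' \<in> carrier R" "b' \<in> carrier R" using q_carrier Bc by auto
    have "x \<oplus> y = (c' \<oplus> c) \<oplus> (b' \<oplus> b) \<otimes> a"
      unfolding x(1) y(1) using xc yc ac by (simp add: l_distr a_ac)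
    then show "x \<oplus> y \<in> J" using JI[OF q_add[OF x(2) y(2)] BE(7)[OF x(3) y(3)]] by simp
    have "x \<in> idealizer"
      unfolding x(1) using x(2,3) q_idealizer a(1) by (intro BE(6,7)) auto
    then show "x \<otimes> y \<in> J" by (rule scale)
  qed
  then have "J = q" using q_maximal[OF _ qJ] contr unfolding J_def by blast
  moreover have "a = \<zero> \<oplus> \<one> \<otimes> a" using ac by simp
  then have "a \<in> J" using JI[OF q_zero BE(3)] by simp
  ultimately show False using a by simp
qed

text \<open>Two factors outside \<open>q\<close> each give an element of \<open>T\<close> by adjoining them; the product of these two elements
lies in \<open>T\<close>, and in \<open>q\<close> as soon as the product of the factors does.\<close>

lemma q_prime:
  assumes a: "a \<in> idealizer" and b: "b \<in> idealizer" and ab: "a \<otimes> b \<in> q"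
  shows "a \<in> q \<or> b \<in> q"
proof (rule ccontr)
  assume "\<not> ?thesis"
  then obtain c d c' d' where
    1: "c \<in> q" "d \<in> idealizer" "c \<oplus> d \<otimes> a \<in> T" and
    2: "c' \<in> q" "d' \<in> idealizer" "c' \<oplus> d' \<otimes> b \<in> T"
    using meets_adjoin a b by meson
  have car: "a \<in> carrier R" "b \<in> carrier R" "c \<in> carrier R" "d \<in> carrier R"
     "c' \<in> carrier R" "d' \<in> carrier R"
    using a b 1 2 S.B_carrier q_carrier by auto
  note BE = subringE[OF subring_idealizer]
  have "(c \<oplus> d \<otimes> a) \<otimes> (c' \<oplus> d' \<otimes> b) =
        (c' \<oplus> d' \<otimes> b) \<otimes> c \<oplus> ((d \<otimes> a) \<otimes> c' \<oplus> (d \<otimes> d') \<otimes> (a \<otimes> b))"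
    using car by (simp add: l_distr r_distr m_ac a_ac)
  moreover have "(c' \<oplus> d' \<otimes> b) \<otimes> c \<in> q" "(d \<otimes> a) \<otimes> c' \<in> q" "(d \<otimes> d') \<otimes> (a \<otimes> b) \<in> q"
    using 1 2 a b ab q_idealizer by (auto intro!: S.U_scale BE(6,7))
  ultimately have "(c \<oplus> d \<otimes> a) \<otimes> (c' \<oplus> d' \<otimes> b) \<in> q" using q_add by simp
  then show False using T_mult[OF 1(3) 2(3)] q_avoids by blast
qed

text \<open>Suppose \<open>z\<close> is integral over \<open>B\<close> but not in \<open>B\<close>. Then \<open>q B[z]\<close> contains some \<open>t \<in> T\<close>, and by the
monic equation \<open>q B[z]\<close> is \<open>q + q z + ... + q z\<^sup>m\<close>. So \<open>t\<close> maps \<open>B[z]\<close> into \<open>q B[z]\<close>, and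
the determinant trick (Nakayama's lemma) leads to a contradiction. In place of a determinant, the powers of
\<open>z\<close> are eliminated one at a time, the highest one first.\<close>

lemma idealizer_integrally_closed:
  assumes z: "z \<in> carrier R" and int: "z [^] Suc m \<in> poly_values R idealizer z m"
  shows "z \<in> idealizer"
proof (rule ccontr)
  assume "z \<notin> idealizer"
  then obtain N t where t: "t \<in> T" "t \<in> poly_values R q z N"
    using meets_outside[OF z] by blast
  let ?M = "poly_values R q z m"
  note BE = subringE[OF subring_idealizer]
  have lead: "a \<otimes> z [^] Suc m \<in> ?M" if a: "a \<in> q" for a
  proof -
    have "z [^] Suc m \<otimes> a \<in> ?M"
      using S.poly_values_mult[OF z, of a 0] int a by simp
    then show ?thesis using a z q_carrier by (subst m_comm) auto
  qed
  have stable: "z \<otimes> p \<in> ?M" if p: "p \<in> ?M" for p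
  proof -
    obtain c a where "c \<in> ?M" "a \<in> q" "z \<otimes> p = c \<oplus> a \<otimes> z [^] Suc m"
      using S.poly_values_shift[OF z p] unfolding S.poly_values_Suc_iff by blast
    then show ?thesis using S.poly_values_add[OF z] lead by simp
  qed
  have pow: "z [^] k \<otimes> p \<in> ?M" if p: "p \<in> ?M" for p and k :: nat
  proof (induction k)
    case 0 then show ?case using p S.poly_values_carrier[OF z, of m] by (simp add: subset_iff)
  next
    case (Suc k)
    have "p \<in> carrier R" using p S.poly_values_carrier[OF z] by blast
    then have "z [^] Suc k \<otimes> p = z \<otimes> (z [^] k \<otimes> p)" using z by (simp add: m_ac)
    then show ?case using stable[OF Suc.IH] by simp
  qed
  have all: "poly_values R q z n \<subseteq> ?M" for n
  proof (induction n)
    case 0 show ?case using S.poly_values_mono[OF z, of 0 m] by simp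
  next
    case (Suc n)
    have "a \<otimes> z [^] Suc n \<in> ?M" if a: "a \<in> q" for a
    proof -
      have "z [^] Suc n \<otimes> a \<in> ?M"
        using pow[of a "Suc n"] S.poly_values_mono[OF z, of 0 m] a by auto
      then show ?thesis using a z q_carrier by (subst m_comm) auto
    qed
    then show ?case using Suc.IH S.poly_values_add[OF z] unfolding poly_values.simps by blast
  qed
  \<comment> \<open>Invariant of the elimination: some \<open>s\<close> outside \<open>q\<close> maps \<open>1, ..., z\<^sup>k\<close> into their span over \<open>q\<close>.\<close>
  have elim: "\<exists>s\<in>idealizer - q. \<forall>i\<le>k. s \<otimes> z [^] i \<in> poly_values R q z k" if "k \<le> m" for k
    using that
  proof (induction k rule: inc_induct)
    case base
    have "t \<otimes> z [^] i \<in> ?M" for i :: nat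
    proof -
      have tM: "t \<in> ?M" using t all by blast
      then have "t \<in> carrier R" using S.poly_values_carrier[OF z] by blast
      then show ?thesis using pow[OF tM, of i] z by (simp add: m_comm)
    qed
    moreover have "t \<in> idealizer - q" using t T_subset A_idealizer q_avoids by blast
    ultimately show ?case by blast
  next
    case (step k)
    then obtain s where s: "s \<in> idealizer" "s \<notin> q"
      and sz: "\<forall>i\<le>Suc k. s \<otimes> z [^] i \<in> poly_values R q z (Suc k)" by blast
    let ?P = "poly_values R q z k" and ?e = "z [^] Suc k"
    have zc: "?e \<in> carrier R" and sc: "s \<in> carrier R" using z s S.B_carrier by auto
    obtain p a where p: "p \<in> ?P" "a \<in> q" "s \<otimes> ?e = p \<oplus> a \<otimes> ?e"
      using sz unfolding S.poly_values_Suc_iff by blast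
    have pc: "p \<in> carrier R" and ac: "a \<in> carrier R"
      using p S.poly_values_carrier[OF z] q_carrier by auto
    \<comment> \<open>The relation for the top power reads \<open>(s - a) z\<^sup>k\<^sup>+\<^sup>1 = p\<close> with \<open>s - a\<close> outside \<open>q\<close>; multiplying the other
      relations by \<open>s - a\<close> therefore removes this power from them.\<close>
    define s' where "s' = s \<ominus> a"
    have s'B: "s' \<in> idealizer"
      unfolding s'_def a_minus_def using s p(2) q_idealizer by (intro BE(5,7)) auto
    then have s'c: "s' \<in> carrier R" using S.B_carrier by blast
    have "s = s' \<oplus> a" unfolding s'_def using sc ac by (simp add: a_minus_def a_assoc l_neg)
    then have s'q: "s' \<notin> q" using s q_add p by metis
    have s'e: "s' \<otimes> ?e = p"
    proof -
      have "s' \<otimes> ?e = s \<otimes> ?e \<ominus> a \<otimes> ?e"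
        unfolding s'_def using sc ac zc by (simp add: a_minus_def l_distr l_minus del: nat_pow_Suc)
      also have "\<dots> = p"
        unfolding p(3) using pc ac zc by (simp add: a_minus_def a_assoc r_neg del: nat_pow_Suc)
      finally show ?thesis .
    qed
    have "(s' \<otimes> s) \<otimes> z [^] i \<in> ?P" if i: "i \<le> k" for i
    proof -
      obtain p' a' where p': "p' \<in> ?P" "a' \<in> q" "s \<otimes> z [^] i = p' \<oplus> a' \<otimes> ?e"
        using sz i unfolding S.poly_values_Suc_iff by (meson le_SucI)
      have c: "p' \<in> carrier R" "a' \<in> carrier R" "z [^] i \<in> carrier R"
        using p' S.poly_values_carrier[OF z] q_carrier z by auto
      have "(s' \<otimes> s) \<otimes> z [^] i = s' \<otimes> p' \<oplus> a' \<otimes> (s' \<otimes> ?e)"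
        using c sc s'c zc p'(3) by (simp add: m_assoc r_distr m_lcomm del: nat_pow_Suc)
      moreover have "s' \<otimes> p' \<in> ?P" "a' \<otimes> p \<in> ?P"
        using S.poly_values_scale[OF z] p(1) p'(1,2) s'B q_idealizer by blast+
      ultimately show ?thesis unfolding s'e using S.poly_values_add[OF z] by simp
    qed
    moreover have "s' \<otimes> s \<in> idealizer - q" using BE(6)[OF s'B s(1)] q_prime[OF s'B s(1)] s'q s(2) by blast
    ultimately show ?case by blast
  qed
  \<comment> \<open>Once only the power \<open>z\<^sup>0 = 1\<close> is left, the relation says that \<open>s\<close> lies in \<open>q\<close>.\<close>
  then obtain s where "s \<in> idealizer" "s \<notin> q" "s \<otimes> z [^] (0::nat) \<in> q"
    using elim[of 0] by auto
  then show False using S.B_carrier by auto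
qed

text \<open>Take a relation \<open>q\<^sub>0 + q\<^sub>1 x + ... + q\<^sub>n x\<^sup>n = t\<close> with \<open>t \<in> T\<close> of least degree. Then \<open>z = q\<^sub>n x\<close> is the
required multiple: it is integral over \<open>B\<close>, hence in \<open>B\<close>, and it is not in \<open>q\<close>, because otherwise
\<open>q\<^sub>n x\<^sup>n = z x\<^sup>n\<^sup>-\<^sup>1\<close> would lower the degree.\<close>

lemma manis_property:
  assumes x: "x \<in> carrier R" "x \<notin> idealizer"
  shows "\<exists>y\<in>q. x \<otimes> y \<in> idealizer - q"
proof -
  note BE = subringE[OF subring_idealizer]
  define P where "P n \<longleftrightarrow> (\<exists>t\<in>T. t \<in> poly_values R q x n)" for n
  define n where "n = (LEAST n. P n)"
  have "\<exists>n. P n" using meets_outside[OF x] unfolding P_def .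
  then have Pn: "P n" unfolding n_def by (rule LeastI_ex)
  have least: "\<not> P k" if "k < n" for k using that unfolding n_def by (rule not_less_Least)
  have "n \<noteq> 0"
  proof
    assume "n = 0"
    then show False using Pn q_avoids unfolding P_def by auto
  qed
  then obtain m where m: "n = Suc m" using not0_implies_Suc by blast
  obtain t p a where t: "t \<in> T" "t = p \<oplus> a \<otimes> x [^] Suc m" and p: "p \<in> poly_values R q x m" and a: "a \<in> q"
    using Pn unfolding P_def m S.poly_values_Suc_iff by blast
  have aB: "a \<in> idealizer" and ac: "a \<in> carrier R" using a q_idealizer q_carrier by auto
  have tB: "t \<in> idealizer" using t T_subset A_idealizer by blast
  have pc: "p \<in> carrier R" using p S.poly_values_carrier[OF x(1)] by blast
  define z where "z = a \<otimes> x"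
  have zc: "z \<in> carrier R" unfolding z_def using ac x by simp
  have "z [^] Suc m = a [^] m \<otimes> (a \<otimes> x [^] Suc m)"
    unfolding z_def using nat_pow_distrib[OF ac x(1), of "Suc m"] ac x by (simp add: m_assoc)
  also have "a \<otimes> x [^] Suc m = t \<ominus> p"
    unfolding t(2) using pc ac x(1) by (simp add: a_minus_def a_ac r_neg2 del: nat_pow_Suc)
  finally have zt: "z [^] Suc m = a [^] m \<otimes> (t \<ominus> p)" .
  have "p \<in> poly_values R idealizer x m" using p poly_values_subset[OF q_idealizer] by blast
  moreover have "t \<in> poly_values R idealizer x m"
    using tB SB.poly_values_mono[OF x(1), of 0 m] by auto
  moreover have "\<ominus> \<one> \<otimes> p = \<ominus> p" using pc by (simp add: l_minus)
  ultimately have "t \<ominus> p \<in> poly_values R idealizer x m"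
    unfolding a_minus_def
    using SB.poly_values_add[OF x(1)] SB.poly_values_scale[OF x(1), of "\<ominus> \<one>"] BE(3,5) by metis
  then have "z [^] Suc m \<in> poly_values R idealizer z m"
    unfolding zt unfolding z_def by (rule SB.poly_values_homogenize[OF x(1) aB])
  then have zB: "z \<in> idealizer" by (rule idealizer_integrally_closed[OF zc])
  moreover have "z \<notin> q"
  proof
    assume zq: "z \<in> q"
    have "a \<otimes> x [^] Suc m = x [^] m \<otimes> z" unfolding z_def using ac x by (simp add: m_ac)
    also have "\<dots> \<in> poly_values R q x m"
      using S.poly_values_shift_pow[OF x(1), of z 0 m] zq by simp
    finally have "t \<in> poly_values R q x m" using S.poly_values_add[OF x(1) p] t by simp
    then show False using least[of m] t m unfolding P_def by auto
  qed
  ultimately show ?thesis using a m_comm[OF x(1) ac] unfolding z_def by (intro bexI[of _ a]) auto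
qed

lemma manis_pair_idealizer: "manis_pair R idealizer q"
proof (intro manis_pair.intro manis_pair_axioms.intro cring_axioms)
  show "subring idealizer R" by (rule subring_idealizer)
  show "\<one> \<notin> q" using T_one q_avoids by blast
qed (use q_idealizer q_zero q_add S.U_scale q_prime manis_property in auto)

end

text \<open>The set \<open>T\<close> is meant to be the complement of a prime ideal \<open>p\<close> of \<open>A\<close>; then \<open>q \<inter> T = {}\<close> says that
\<open>q\<close> lies over \<open>p\<close>, so the pair found dominates \<open>(A, p)\<close>.\<close>

theorem (in cring) manis_pair_exists:
  assumes A: "subring A R" and T: "T \<subseteq> A" "\<one> \<in> T" "\<And>s t. \<lbrakk>s \<in> T; t \<in> T\<rbrakk> \<Longrightarrow> s \<otimes> t \<in> T"
    and p: "closed_over A p" "p \<inter> T = {}"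
  obtains B q where "manis_pair R B q" "A \<subseteq> B" "p \<subseteq> q" "q \<inter> T = {}"
proof -
  define X where "X = {I. closed_over A I \<and> p \<subseteq> I \<and> I \<inter> T = {}}"
  have "\<exists>M\<in>X. \<forall>J\<in>X. M \<subseteq> J \<longrightarrow> J = M"
  proof (rule subset_Zorn_nonempty)
    show "X \<noteq> {}" using p unfolding X_def by blast
    fix K assume K: "K \<noteq> {}" "subset.chain X K"
    then have KX: "closed_over A I" "p \<subseteq> I" "I \<inter> T = {}" if "I \<in> K" for I
      using that unfolding X_def subset_chain_def by auto
    have "closed_over A (\<Union>K)"
      unfolding closed_over_def
    proof (intro conjI ballI)
      fix a b assume a: "a \<in> \<Union>K" and b: "b \<in> \<Union>K"
      then obtain I where "I \<in> K" "a \<in> I" "b \<in> I"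
        using K(2) unfolding subset_chain_def by blast
      then show "a \<oplus> b \<in> \<Union>K" "a \<otimes> b \<in> \<Union>K"
        using KX(1)[of I] unfolding closed_over_def by blast+
    qed (use KX(1) K(1) in \<open>fastforce simp: closed_over_def\<close>)+
    then show "\<Union>K \<in> X" using KX(2,3) K(1) unfolding X_def by blast
  qed
  then obtain q where q: "q \<in> X" and max: "\<And>J. J \<in> X \<Longrightarrow> q \<subseteq> J \<Longrightarrow> J = q" by blast
  interpret maximal_avoiding R A T q
  proof (intro maximal_avoiding.intro maximal_avoiding_axioms.intro cring_axioms)
    show "closed_over A q" "q \<inter> T = {}" using q unfolding X_def by auto
    show "J = q" if "closed_over A J" "q \<subseteq> J" "J \<inter> T = {}" for J
      using max[of J] that q unfolding X_def by blast
  qed (fact A T)+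
  show ?thesis using that[OF manis_pair_idealizer A_idealizer] q unfolding X_def by blast
qed

section \<open>The valuation of a Manis pair\<close>

context manis_pair
begin

text \<open>The value of \<open>x\<close> is encoded by the set of all \<open>z\<close> with \<open>v z > - v x\<close>.\<close>

definition transporter :: "'a \<Rightarrow> 'a set" where
  "transporter x = {z \<in> carrier R. x \<otimes> z \<in> q}"

lemma transporterI: "\<lbrakk>z \<in> carrier R; x \<otimes> z \<in> q\<rbrakk> \<Longrightarrow> z \<in> transporter x"
  and transporterD: "z \<in> transporter x \<Longrightarrow> x \<otimes> z \<in> q"
  and transporter_carrier: "z \<in> transporter x \<Longrightarrow> z \<in> carrier R"
  unfolding transporter_def by auto

lemma subring_carrier: "x \<in> B \<Longrightarrow> x \<in> carrier R"
  using subringE(1)[OF subring] by blast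

lemma ideal_carrier: "x \<in> q \<Longrightarrow> x \<in> carrier R"
  using ideal_subset subring_carrier by blast

lemma multiple_in_ring_outside_ideal:
  assumes a: "a \<in> carrier R" "a \<notin> q"
  shows "\<exists>b\<in>B. a \<otimes> b \<in> B - q"
proof (cases "a \<in> B")
  case True
  then have "a \<otimes> \<one> \<in> B - q" using a by simp
  then show ?thesis using subringE(3)[OF subring] by blast
next
  case False
  then show ?thesis using manis[OF a(1)] ideal_subset by blast
qed

text \<open>The complement of \<open>q\<close> in the whole ring consists of the elements of value at most \<open>0\<close>. Scaling
both factors into \<open>B - q\<close> reduces the claim to primality of \<open>q\<close> in \<open>B\<close>.\<close>

lemma complement_mult:
  assumes a: "a \<in> carrier R" "a \<notin> q" and b: "b \<in> carrier R" "b \<notin> q"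
  shows "a \<otimes> b \<notin> q"
proof
  assume ab: "a \<otimes> b \<in> q"
  obtain c d where c: "c \<in> B" "a \<otimes> c \<in> B - q" and d: "d \<in> B" "b \<otimes> d \<in> B - q"
    using multiple_in_ring_outside_ideal a b by meson
  have "(c \<otimes> d) \<otimes> (a \<otimes> b) \<in> q"
    by (intro ideal_absorb subringE(6)[OF subring] c(1) d(1) ab)
  moreover have "(c \<otimes> d) \<otimes> (a \<otimes> b) = (a \<otimes> c) \<otimes> (b \<otimes> d)"
    using a b c(1) d(1) subring_carrier by (simp add: m_ac)
  ultimately show False using prime[of "a \<otimes> c" "b \<otimes> d"] c d by simp
qed

text \<open>If neither set contained the other, say \<open>x z\<close> and \<open>y u\<close> are in \<open>q\<close> but \<open>y z\<close> and \<open>x u\<close> are not, then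
\<open>(x z) (y u) = (y z) (x u)\<close> would be both in \<open>q\<close> and outside of it.\<close>

lemma transporter_linear:
  assumes x: "x \<in> carrier R" and y: "y \<in> carrier R"
  shows "transporter x \<subseteq> transporter y \<or> transporter y \<subseteq> transporter x"
proof (rule ccontr)
  assume "\<not> ?thesis"
  then obtain z u where z: "z \<in> carrier R" "x \<otimes> z \<in> q" "y \<otimes> z \<notin> q"
    and u: "u \<in> carrier R" "y \<otimes> u \<in> q" "x \<otimes> u \<notin> q"
    unfolding transporter_def by blast
  have "(x \<otimes> z) \<otimes> (y \<otimes> u) \<in> q" using z u ideal_subset ideal_absorb by blast
  moreover have "(x \<otimes> z) \<otimes> (y \<otimes> u) = (y \<otimes> z) \<otimes> (x \<otimes> u)"
    using x y z u by (simp add: m_ac)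
  ultimately show False using complement_mult[of "y \<otimes> z" "x \<otimes> u"] x y z u by simp
qed

lemma transporter_mult_iff:
  assumes "x \<in> carrier R" "y \<in> carrier R" "z \<in> carrier R"
  shows "z \<in> transporter (x \<otimes> y) \<longleftrightarrow> y \<otimes> z \<in> transporter x"
  using assms unfolding transporter_def by (simp add: m_assoc)

lemma transporter_mult_mono:
  assumes "transporter x \<subseteq> transporter x'"
    and "x \<in> carrier R" "x' \<in> carrier R" "y \<in> carrier R"
  shows "transporter (x \<otimes> y) \<subseteq> transporter (x' \<otimes> y)"
proof
  fix z assume z: "z \<in> transporter (x \<otimes> y)"
  then have "z \<in> carrier R" by (rule transporter_carrier)
  then show "z \<in> transporter (x' \<otimes> y)"
    using z assms transporter_mult_iff by blast
qed

lemma transporter_mult_cong: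
  assumes "transporter x = transporter x'" "transporter y = transporter y'"
    and "x \<in> carrier R" "x' \<in> carrier R" "y \<in> carrier R" "y' \<in> carrier R"
  shows "transporter (x \<otimes> y) = transporter (x' \<otimes> y')"
proof -
  have "transporter (x \<otimes> y) = transporter (x' \<otimes> y)"
    using transporter_mult_mono[of x x' y] transporter_mult_mono[of x' x y] assms by blast
  also have "\<dots> = transporter (x' \<otimes> y')"
    using transporter_mult_mono[of y y' x'] transporter_mult_mono[of y' y x'] assms
    by (simp add: m_comm[of x'])
  finally show ?thesis .
qed

lemma transporter_unit:
  assumes b: "b \<in> B" "b \<notin> q"
  shows "transporter b = q"
proof
  show "q \<subseteq> transporter b"
    using b ideal_carrier ideal_absorb transporterI by blast
  show "transporter b \<subseteq> q"
    using complement_mult[OF subring_carrier b(2)] b transporterD transporter_carrier by blast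
qed

lemma transporter_one: "transporter \<one> = q"
  using transporter_unit[OF subringE(3)[OF subring] one_notin] .

lemma transporter_zero: "transporter \<zero> = carrier R"
  unfolding transporter_def using ideal_zero by auto

lemma one_in_transporter: "x \<in> q \<Longrightarrow> \<one> \<in> transporter x"
  using transporterI[of \<one> x] ideal_carrier by simp

lemma ideal_proper: "q \<noteq> carrier R"
  using one_notin by blast

text \<open>Elements of finite value have an inverse up to elements of value \<open>0\<close>; this makes the finite values a group.\<close>

lemma transporter_inverse:
  assumes x: "x \<in> carrier R" "transporter x \<noteq> carrier R"
  shows "\<exists>y\<in>carrier R. transporter (x \<otimes> y) = q"
proof -
  obtain z where z: "z \<in> carrier R" "x \<otimes> z \<notin> q"
    using x(2) unfolding transporter_def by blast
  obtain b where b: "b \<in> B" "x \<otimes> z \<otimes> b \<in> B - q"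
    using multiple_in_ring_outside_ideal[of "x \<otimes> z"] x z by blast
  then have "transporter (x \<otimes> (z \<otimes> b)) = q"
    using x z subring_carrier[OF b(1)] transporter_unit[of "x \<otimes> z \<otimes> b"] by (simp add: m_assoc)
  then show ?thesis using z subring_carrier[OF b(1)] by blast
qed

lemma transporter_mult_infinite:
  assumes x: "x \<in> carrier R" "transporter x = carrier R" and y: "y \<in> carrier R"
  shows "transporter (x \<otimes> y) = carrier R"
proof -
  have "transporter (\<zero> \<otimes> y) \<subseteq> transporter (x \<otimes> y)"
    by (rule transporter_mult_mono) (use x y transporter_zero in auto)
  then show ?thesis using y transporter_zero transporter_carrier by auto
qed

lemma transporter_mult_finite:
  assumes x: "x \<in> carrier R" "transporter x \<noteq> carrier R"
    and y: "y \<in> carrier R" "transporter y \<noteq> carrier R"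
  shows "transporter (x \<otimes> y) \<noteq> carrier R"
proof
  assume inf: "transporter (x \<otimes> y) = carrier R"
  obtain z where z: "z \<in> carrier R" "transporter (y \<otimes> z) = q"
    using transporter_inverse[OF y] by blast
  have "transporter x = transporter (x \<otimes> \<one>)" using x by simp
  also have "\<dots> = transporter (x \<otimes> (y \<otimes> z))"
    by (rule transporter_mult_cong) (use x y z transporter_one in auto)
  also have "\<dots> = transporter (x \<otimes> y \<otimes> z)" using x y z by (simp add: m_assoc)
  also have "\<dots> = carrier R"
    using transporter_mult_infinite[OF _ inf] x y z by simp
  finally show False using x by simp
qed

lemma transporter_square_zero:
  assumes x: "x \<in> carrier R" "x \<otimes> x = \<zero>"
  shows "transporter x = carrier R"
  using transporter_mult_finite[OF x(1) _ x(1)] x transporter_zero by auto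

lemma transporter_add:
  assumes "x \<in> carrier R" "y \<in> carrier R" "transporter x \<subseteq> transporter y"
  shows "transporter x \<subseteq> transporter (x \<oplus> y)"
proof
  fix z assume z: "z \<in> transporter x"
  then have zc: "z \<in> carrier R" by (rule transporter_carrier)
  have "x \<otimes> z \<oplus> y \<otimes> z \<in> q" using z assms transporterD ideal_add by blast
  then show "z \<in> transporter (x \<oplus> y)"
    using zc assms by (intro transporterI) (simp_all add: l_distr)
qed

lemma transporter_add_infinite:
  assumes x: "x \<in> carrier R" and y: "y \<in> carrier R" "transporter y = carrier R"
  shows "transporter (x \<oplus> y) = transporter x"
proof
  show "transporter x \<subseteq> transporter (x \<oplus> y)"
    using transporter_add[OF x y(1)] y(2) transporter_carrier by blast
  have "transporter (x \<oplus> y) \<subseteq> transporter ((x \<oplus> y) \<oplus> (y \<otimes> \<ominus> \<one>))"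
    by (rule transporter_add)
      (use x y transporter_mult_infinite[OF y] transporter_carrier in auto)
  also have "(x \<oplus> y) \<oplus> (y \<otimes> \<ominus> \<one>) = x"
    using x y by (simp add: a_assoc r_minus r_neg)
  finally show "transporter (x \<oplus> y) \<subseteq> transporter x" .
qed

text \<open>The set \<open>q\<close> is the transporter of \<open>1\<close>, that is, the value \<open>0\<close>. So the next two lemmas recover \<open>B\<close> and
\<open>q\<close> as the elements of nonnegative and of positive value.\<close>

lemma in_subring_iff:
  assumes x: "x \<in> carrier R"
  shows "x \<in> B \<longleftrightarrow> q \<subseteq> transporter x"
proof
  assume "x \<in> B"
  then show "q \<subseteq> transporter x" using ideal_absorb ideal_carrier transporterI by blast
next
  assume "q \<subseteq> transporter x"
  then show "x \<in> B" using manis[OF x] transporterD by blast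
qed

lemma in_ideal_iff:
  assumes x: "x \<in> carrier R"
  shows "x \<in> q \<longleftrightarrow> q \<subset> transporter x"
proof
  assume xq: "x \<in> q"
  then have "\<one> \<in> transporter x" by (rule one_in_transporter)
  then show "q \<subset> transporter x" using one_notin xq ideal_subset in_subring_iff[OF x] by blast
next
  assume "q \<subset> transporter x"
  then show "x \<in> q" using in_subring_iff[OF x] transporter_unit by blast
qed

text \<open>An element has infinite value if its transporter is the whole ring, so these are left out.
The product does not depend on the chosen representatives by \<open>transporter_mult_cong\<close>.\<close>

definition value_group :: "'a set ordered_group" where
  "value_group =
    \<lparr>carrier = {transporter x | x. x \<in> carrier R \<and> transporter x \<noteq> carrier R},
     mult = (\<lambda>a b. THE c. \<exists>x\<in>carrier R. \<exists>y\<in>carrier R.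
       a = transporter x \<and> b = transporter y \<and> c = transporter (x \<otimes> y)),
     one = q,
     ord_rel = {(transporter x, transporter y) | x y. x \<in> carrier R \<and> y \<in> carrier R \<and>
       transporter x \<noteq> carrier R \<and> transporter y \<noteq> carrier R \<and> transporter x \<subseteq> transporter y}\<rparr>"

lemma value_group_carrier:
  "carrier value_group = {transporter x | x. x \<in> carrier R \<and> transporter x \<noteq> carrier R}"
  unfolding value_group_def by simp

lemma value_group_one: "\<one>\<^bsub>value_group\<^esub> = q"
  unfolding value_group_def by simp

lemma value_group_mult:
  assumes "x \<in> carrier R" "y \<in> carrier R"
  shows "transporter x \<otimes>\<^bsub>value_group\<^esub> transporter y = transporter (x \<otimes> y)"
proof -
  have "(THE c. \<exists>x'\<in>carrier R. \<exists>y'\<in>carrier R.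
      transporter x = transporter x' \<and> transporter y = transporter y' \<and> c = transporter (x' \<otimes> y'))
    = transporter (x \<otimes> y)"
  proof (rule the_equality)
    show "\<exists>x'\<in>carrier R. \<exists>y'\<in>carrier R. transporter x = transporter x' \<and>
        transporter y = transporter y' \<and> transporter (x \<otimes> y) = transporter (x' \<otimes> y')"
      using assms by blast
    fix c assume "\<exists>x'\<in>carrier R. \<exists>y'\<in>carrier R. transporter x = transporter x' \<and>
        transporter y = transporter y' \<and> c = transporter (x' \<otimes> y')"
    then obtain x' y' where c: "c = transporter (x' \<otimes> y')" and
      eq: "transporter x = transporter x'" "transporter y = transporter y'" and
      car: "x' \<in> carrier R" "y' \<in> carrier R" by blast
    show "c = transporter (x \<otimes> y)"
      unfolding c by (rule transporter_mult_cong[OF eq assms(1) car(1) assms(2) car(2), symmetric])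
  qed
  then show ?thesis unfolding value_group_def by simp
qed

lemma value_group_le:
  assumes "a \<in> carrier value_group" "b \<in> carrier value_group"
  shows "(a, b) \<in> ord_rel value_group \<longleftrightarrow> a \<subseteq> b"
  using assms unfolding value_group_def by auto

lemma value_groupE:
  assumes "a \<in> carrier value_group"
  obtains x where "x \<in> carrier R" "transporter x \<noteq> carrier R" "a = transporter x"
  using assms unfolding value_group_carrier by blast

lemma value_groupI:
  "\<lbrakk>x \<in> carrier R; transporter x \<noteq> carrier R\<rbrakk> \<Longrightarrow> transporter x \<in> carrier value_group"
  unfolding value_group_carrier by blast

lemma value_group_comm_group: "comm_group value_group"
proof (rule comm_groupI)
  show one: "\<one>\<^bsub>value_group\<^esub> \<in> carrier value_group"
    using value_groupI[of \<one>] transporter_one ideal_proper by (simp add: value_group_one)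
  fix a assume "a \<in> carrier value_group"
  then obtain x where x: "x \<in> carrier R" "transporter x \<noteq> carrier R" "a = transporter x"
    by (rule value_groupE)
  show "\<one>\<^bsub>value_group\<^esub> \<otimes>\<^bsub>value_group\<^esub> a = a"
    using value_group_mult[of \<one> x] x transporter_one by (simp add: value_group_one)
  obtain x' where x': "x' \<in> carrier R" "transporter (x \<otimes> x') = q"
    using transporter_inverse[OF x(1,2)] by blast
  have "transporter x' \<noteq> carrier R"
    using transporter_mult_infinite[of x' x] x' x ideal_proper by (auto simp: m_comm)
  moreover have "transporter x' \<otimes>\<^bsub>value_group\<^esub> a = q"
    using value_group_mult[of x' x] x x' by (simp add: m_comm)
  ultimately show "\<exists>y\<in>carrier value_group. y \<otimes>\<^bsub>value_group\<^esub> a = \<one>\<^bsub>value_group\<^esub>"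
    using x' value_groupI unfolding value_group_one by blast
  fix b assume "b \<in> carrier value_group"
  then obtain y where y: "y \<in> carrier R" "transporter y \<noteq> carrier R" "b = transporter y"
    by (rule value_groupE)
  show "a \<otimes>\<^bsub>value_group\<^esub> b \<in> carrier value_group"
    using x y value_group_mult transporter_mult_finite value_groupI by simp
  show "a \<otimes>\<^bsub>value_group\<^esub> b = b \<otimes>\<^bsub>value_group\<^esub> a"
    using x y value_group_mult by (simp add: m_comm)
  fix c assume "c \<in> carrier value_group"
  then obtain z where z: "z \<in> carrier R" "transporter z \<noteq> carrier R" "c = transporter z"
    by (rule value_groupE)
  show "a \<otimes>\<^bsub>value_group\<^esub> b \<otimes>\<^bsub>value_group\<^esub> c = a \<otimes>\<^bsub>value_group\<^esub> (b \<otimes>\<^bsub>value_group\<^esub> c)"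
    using x y z value_group_mult by (simp add: m_assoc)
qed

lemma value_group_ordered: "ordered_abelian_group value_group"
proof (intro ordered_abelian_group.intro ordered_abelian_group_axioms.intro value_group_comm_group)
  interpret G: comm_group value_group by (rule value_group_comm_group)
  have sub: "ord_rel value_group \<subseteq> carrier value_group \<times> carrier value_group"
    unfolding value_group_def by auto
  have le_iff: "(a, b) \<in> ord_rel value_group \<longleftrightarrow>
      a \<in> carrier value_group \<and> b \<in> carrier value_group \<and> a \<subseteq> b" for a b
    using sub value_group_le[of a b] by blast
  have lin: "a \<subseteq> b \<or> b \<subseteq> a" if "a \<in> carrier value_group" "b \<in> carrier value_group" for a b
    using that transporter_linear by (elim value_groupE) simp
  show "linear_order_on (carrier value_group) (ord_rel value_group)"
    unfolding order_on_defs
  proof (intro conjI)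
    show "refl_on (carrier value_group) (ord_rel value_group)"
      by (intro refl_onI) (simp add: value_group_le)
    show "trans (ord_rel value_group)"
    proof (rule transI)
      fix a b c assume "(a, b) \<in> ord_rel value_group" "(b, c) \<in> ord_rel value_group"
      then show "(a, c) \<in> ord_rel value_group" unfolding le_iff by auto
    qed
    show "antisym (ord_rel value_group)"
      by (rule antisymI) (simp add: le_iff)
    show "total_on (carrier value_group) (ord_rel value_group)"
      by (rule total_onI) (use lin in \<open>simp add: le_iff\<close>)
  qed (rule sub)
  fix a b c
  assume ab: "(a, b) \<in> ord_rel value_group" and c: "c \<in> carrier value_group"
  then have abG: "a \<in> carrier value_group" "b \<in> carrier value_group" using sub by auto
  obtain x where x: "x \<in> carrier R" "a = transporter x" using abG(1) by (rule value_groupE)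
  obtain y where y: "y \<in> carrier R" "b = transporter y" using abG(2) by (rule value_groupE)
  obtain z where z: "z \<in> carrier R" "c = transporter z" using c by (rule value_groupE)
  note xyz = x y z
  have "transporter x \<subseteq> transporter y" using ab abG value_group_le xyz by blast
  then have "a \<otimes>\<^bsub>value_group\<^esub> c \<subseteq> b \<otimes>\<^bsub>value_group\<^esub> c"
    using xyz transporter_mult_mono value_group_mult by simp
  then show "(a \<otimes>\<^bsub>value_group\<^esub> c, b \<otimes>\<^bsub>value_group\<^esub> c) \<in> ord_rel value_group"
    using value_group_le abG c by simp
qed

definition value_of :: "'a \<Rightarrow> 'a set option" where
  "value_of x = (if transporter x = carrier R then None else Some (transporter x))"

lemma value_of_le_iff:
  assumes "x \<in> carrier R" "y \<in> carrier R"
  shows "val_le value_group (value_of x) (value_of y) \<longleftrightarrow> transporter x \<subseteq> transporter y"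
proof -
  have sub: "transporter x \<subseteq> carrier R" "transporter y \<subseteq> carrier R"
    using transporter_carrier by blast+
  show ?thesis
    using sub value_groupI[OF assms(1)] value_groupI[OF assms(2)]
    by (auto simp: value_of_def value_group_le)
qed

lemma value_of_mult:
  assumes "x \<in> carrier R" "y \<in> carrier R"
  shows "value_of (x \<otimes> y) = val_add value_group (value_of x) (value_of y)"
  using assms transporter_mult_infinite[of x y] transporter_mult_infinite[of y x]
    transporter_mult_finite[of x y] value_group_mult[of x y]
  by (auto simp: value_of_def m_comm)

lemma value_of_add:
  assumes x: "x \<in> carrier R" and y: "y \<in> carrier R"
  shows "val_le value_group (val_min value_group (value_of x) (value_of y)) (value_of (x \<oplus> y))"
proof (cases "transporter x \<subseteq> transporter y")
  case True
  then show ?thesis using x y transporter_add[OF x y] by (simp add: val_min_def value_of_le_iff)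
next
  case False
  then have "transporter y \<subseteq> transporter x" using transporter_linear[OF x y] by blast
  then show ?thesis
    using False x y transporter_add[OF y x] by (simp add: val_min_def value_of_le_iff a_comm)
qed

lemma value_of_image: "value_of ` carrier R = insert None (Some ` carrier value_group)"
proof
  show "value_of ` carrier R \<subseteq> insert None (Some ` carrier value_group)"
    using value_groupI by (auto simp: value_of_def)
  have "None = value_of \<zero>" using transporter_zero by (simp add: value_of_def)
  moreover have "Some a \<in> value_of ` carrier R" if "a \<in> carrier value_group" for a
    using that by (elim value_groupE) (auto simp: value_of_def)
  ultimately show "insert None (Some ` carrier value_group) \<subseteq> value_of ` carrier R" by auto
qed

lemma value_of_one: "value_of \<one> = val_zero value_group"
  using ideal_proper by (simp add: value_of_def transporter_one val_zero_def value_group_one)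

lemma value_of_nonneg_iff:
  "x \<in> carrier R \<Longrightarrow> val_le value_group (val_zero value_group) (value_of x) \<longleftrightarrow> x \<in> B"
  by (simp add: value_of_one[symmetric] value_of_le_iff transporter_one in_subring_iff)

lemma value_of_pos_iff:
  assumes x: "x \<in> carrier R"
  shows "val_less value_group (val_zero value_group) (value_of x) \<longleftrightarrow> x \<in> q"
proof -
  have "value_of \<one> \<noteq> value_of x \<longleftrightarrow> transporter x \<noteq> q"
    using ideal_proper by (auto simp: value_of_def transporter_one)
  then show ?thesis
    using x by (auto simp: val_less_def value_of_one[symmetric] value_of_le_iff transporter_one
        in_ideal_iff psubset_eq)
qed

end

section \<open>Comparing values of ring elements\<close>

lemma restrict_superring_simps [simp]:
  "carrier (restrict_superring S R) = R"
  "even_part (restrict_superring S R) = R \<inter> even_part S"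
  "odd_part (restrict_superring S R) = R \<inter> odd_part S"
  "mult (restrict_superring S R) = mult S"
  "add (restrict_superring S R) = add S"
  "one (restrict_superring S R) = one S"
  "zero (restrict_superring S R) = zero S"
  unfolding restrict_superring_def by simp_all

context ordered_abelian_group
begin

lemma le_refl: "a \<in> carrier G \<Longrightarrow> (a, a) \<in> ord_rel G"
  using linear_order unfolding order_on_defs by (elim conjE) (rule refl_onD)

lemma le_trans: "\<lbrakk>(a, b) \<in> ord_rel G; (b, c) \<in> ord_rel G\<rbrakk> \<Longrightarrow> (a, c) \<in> ord_rel G"
  using linear_order unfolding order_on_defs by (elim conjE) (rule transD)

lemma le_antisym: "\<lbrakk>(a, b) \<in> ord_rel G; (b, a) \<in> ord_rel G\<rbrakk> \<Longrightarrow> a = b"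
  using linear_order unfolding order_on_defs by (elim conjE) (rule antisymD)

lemma le_total:
  "\<lbrakk>a \<in> carrier G; b \<in> carrier G\<rbrakk> \<Longrightarrow> (a, b) \<in> ord_rel G \<or> (b, a) \<in> ord_rel G"
  using linear_order le_refl[of a] unfolding order_on_defs total_on_def by (cases "a = b") auto

lemma le_cancel:
  assumes abc: "(a \<otimes> c, b \<otimes> c) \<in> ord_rel G"
    and a: "a \<in> carrier G" and b: "b \<in> carrier G" and c: "c \<in> carrier G"
  shows "(a, b) \<in> ord_rel G"
proof -
  have "(a \<otimes> c \<otimes> inv c, b \<otimes> c \<otimes> inv c) \<in> ord_rel G"
    using translation[OF abc] c by simp
  then show ?thesis using a b c by (simp add: m_assoc)
qed

end

context valuation
begin

abbreviation below :: "'a \<Rightarrow> 'a \<Rightarrow> bool" (infix "\<preceq>" 50) where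
  "x \<preceq> y \<equiv> val_le G (v x) (v y)"

lemma value_cases:
  assumes "x \<in> carrier R"
  obtains "v x = None" | g where "g \<in> carrier G" "v x = Some g"
  using imageI[OF assms, of v] that unfolding surjective by auto

lemma below_refl: "x \<in> carrier R \<Longrightarrow> x \<preceq> x"
  by (erule value_cases) (auto simp: value_group.le_refl)

lemma below_trans: "\<lbrakk>x \<preceq> y; y \<preceq> z\<rbrakk> \<Longrightarrow> x \<preceq> z"
  by (cases "v x"; cases "v y"; cases "v z") (simp_all, rule value_group.le_trans)

lemma below_linear:
  assumes x: "x \<in> carrier R" and y: "y \<in> carrier R"
  shows "x \<preceq> y \<or> y \<preceq> x"
  by (rule value_cases[OF x]; rule value_cases[OF y]) (auto simp: value_group.le_total)

lemma value_eq_iff: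
  assumes x: "x \<in> carrier R"
  shows "v x = v y \<longleftrightarrow> x \<preceq> y \<and> y \<preceq> x"
  using below_refl[OF x] by (cases "v x"; cases "v y") (auto intro: value_group.le_antisym)

lemma value_mult_comm:
  assumes x: "x \<in> carrier R" and y: "y \<in> carrier R"
  shows "v (x \<otimes> y) = v (y \<otimes> x)"
  using val_of_mult[OF x y] val_of_mult[OF y x]
  by (rule_tac value_cases[OF x]; rule_tac value_cases[OF y]) (auto simp: value_group.m_comm)

lemma below_mult:
  assumes x: "x \<in> carrier R" and y: "y \<in> carrier R" and z: "z \<in> carrier R" and xy: "x \<preceq> y"
  shows "x \<otimes> z \<preceq> y \<otimes> z"
  using xy val_of_mult[OF x z] val_of_mult[OF y z]
  by (rule_tac value_cases[OF x]; rule_tac value_cases[OF y]; rule_tac value_cases[OF z])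
    (simp_all add: value_group.translation)

lemma below_cancel:
  assumes x: "x \<in> carrier R" and y: "y \<in> carrier R" and z: "z \<in> carrier R" "v z \<noteq> None"
    and xy: "x \<otimes> z \<preceq> y \<otimes> z"
  shows "x \<preceq> y"
proof -
  obtain c where c: "c \<in> carrier G" "v z = Some c"
    using z(2) by (rule_tac value_cases[OF z(1)]) auto
  have "(a, b) \<in> ord_rel G" if "a \<in> carrier G" "b \<in> carrier G" "v x = Some a" "v y = Some b" for a b
    using xy that c value_group.le_cancel[of a c b] by (simp add: val_of_mult x y z(1))
  then show ?thesis
    using xy by (rule_tac value_cases[OF x]; rule_tac value_cases[OF y])
      (simp_all add: val_of_mult x y z(1) c(2))
qed

lemma infinite_mult: "\<lbrakk>x \<in> carrier R; y \<in> carrier R; v x = None\<rbrakk> \<Longrightarrow> v (x \<otimes> y) = None"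
  by (simp add: val_of_mult)

lemma one_finite: "v \<one> \<noteq> None"
  by (simp add: val_of_one val_zero_def)

text \<open>Since every element of the value group is a value, a finite value can be moved to \<open>0\<close> by multiplication.\<close>

lemma inverse_value_exists:
  assumes x: "x \<in> carrier R" "v x \<noteq> None"
  shows "\<exists>y\<in>carrier R. v (x \<otimes> y) = v \<one>"
proof -
  obtain g where g: "g \<in> carrier G" "v x = Some g"
    using x(2) by (rule_tac value_cases[OF x(1)]) auto
  then have "Some (inv\<^bsub>G\<^esub> g) \<in> v ` carrier R" using surjective by simp
  then obtain y where "y \<in> carrier R" "v y = Some (inv\<^bsub>G\<^esub> g)" by (metis imageE)
  then show ?thesis using x g val_of_mult[of x y] by (auto simp: val_of_one val_zero_def)
qed

lemma below_add:
  assumes "x \<in> carrier R" "y \<in> carrier R" "z \<preceq> x" "z \<preceq> y"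
  shows "z \<preceq> x \<oplus> y"
proof -
  have "val_min G (v x) (v y) = v x \<or> val_min G (v x) (v y) = v y"
    by (simp add: val_min_def)
  then have "x \<preceq> x \<oplus> y \<or> y \<preceq> x \<oplus> y"
    using val_of_add[OF assms(1,2)] by auto
  then show ?thesis using below_trans assms(3,4) by blast
qed

lemma some_summand_below_sum:
  assumes "x \<in> carrier R" "y \<in> carrier R"
  shows "x \<preceq> x \<oplus> y \<or> y \<preceq> x \<oplus> y"
  using below_linear[OF assms] below_add[OF assms, of x] below_add[OF assms, of y]
    below_refl assms by blast

lemma some_term_below_finsum:
  assumes "finite F" "F \<noteq> {}" "f \<in> F \<rightarrow> carrier R"
  shows "\<exists>j\<in>F. f j \<preceq> finsum R f F"
  using assms
proof (induction F rule: finite_ne_induct)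
  case (singleton j) then show ?case using below_refl by simp
next
  case (insert i F)
  then have car: "f i \<in> carrier R" "finsum R f F \<in> carrier R" by auto
  obtain j where j: "j \<in> F" "f j \<preceq> finsum R f F" using insert by auto
  have "finsum R f (insert i F) = f i \<oplus> finsum R f F" using insert by simp
  then show ?case using some_summand_below_sum[OF car] j below_trans[OF j(2)] by auto
qed

lemma minimal_value_exists:
  assumes "finite F" "F \<noteq> {}" "f \<in> F \<rightarrow> carrier R"
  shows "\<exists>i\<in>F. \<forall>j\<in>F. f i \<preceq> f j"
  using assms
proof (induction F rule: finite_ne_induct)
  case (singleton j) then show ?case using below_refl by simp
next
  case (insert i F)
  obtain k where k: "k \<in> F" "\<forall>j\<in>F. f k \<preceq> f j" using insert by auto
  have car: "f i \<in> carrier R" "f k \<in> carrier R" using insert k by auto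
  show ?case
  proof (cases "f i \<preceq> f k")
    case True
    then have "\<forall>j\<in>insert i F. f i \<preceq> f j" using k below_trans below_refl[OF car(1)] by blast
    then show ?thesis by blast
  next
    case False
    then have "\<forall>j\<in>insert i F. f k \<preceq> f j" using k below_linear[OF car] by blast
    then show ?thesis using k by blast
  qed
qed

text \<open>Compare values in \<open>s x\<^sub>i = r\<^sub>1 x\<^sub>1 + ... + r\<^sub>n x\<^sub>n\<close>, where \<open>x\<^sub>i\<close> is a generator of least value. Its value is finite
because \<open>1\<close>, of finite value, is a combination of the generators; so it can be cancelled from
\<open>r\<^sub>j x\<^sub>i \<le> r\<^sub>j x\<^sub>j \<le> s x\<^sub>i\<close>, where the \<open>j\<close>-th summand is one whose value is at most that of the sum.\<close>

lemma homogeneous_integral_bound: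
  assumes A: "subring A R" and s: "homogeneous_integral R A s"
  shows "\<exists>r\<in>A. r \<preceq> s"
proof -
  obtain n xs where xs: "\<forall>i\<in>{1..n}. xs i \<in> even_part R \<inter> ring_center R"
    and one: "\<one> \<in> span_over R A n xs"
    and stable: "\<forall>m\<in>span_over R A n xs. s \<otimes> m \<in> span_over R A n xs"
    and hom: "s \<in> even_part R \<union> odd_part R"
    using s unfolding homogeneous_integral_def by blast
  have sc: "s \<in> carrier R"
    using hom additive_subgroup.a_subset[OF even_subgroup] additive_subgroup.a_subset[OF odd_subgroup]
    by blast
  note Ac = subringE(1)[OF A]
  have xc: "xs i \<in> carrier R" if "i \<in> {1..n}" for i
    using xs that unfolding ring_center_def by blast
  obtain c where c: "c \<in> {1..n} \<rightarrow> A" "\<one> = (\<Oplus>i\<in>{1..n}. c i \<otimes> xs i)"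
    using one unfolding span_over_def by blast
  have cc: "(\<lambda>i. c i \<otimes> xs i) \<in> {1..n} \<rightarrow> carrier R" using c(1) xc Ac by fast
  have ne: "{1..n} \<noteq> {}"
  proof
    assume "{1..n} = {}"
    then show False using c(2) one_neq_zero by (simp only: finsum_empty)
  qed
  obtain i where i: "i \<in> {1..n}" "\<forall>j\<in>{1..n}. xs i \<preceq> xs j"
    using minimal_value_exists[of "{1..n}" xs] ne xc by auto
  have "v (xs i) \<noteq> None"
  proof
    assume inf: "v (xs i) = None"
    obtain j where j: "j \<in> {1..n}" "c j \<otimes> xs j \<preceq> \<one>"
      using some_term_below_finsum[OF _ ne cc] c(2) by auto
    have cj: "c j \<in> carrier R" using c(1) j Ac by auto
    have "xs i \<preceq> xs j" using i(2) j(1) by blast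
    then have "v (xs j) = None" using inf by (cases "v (xs j)") auto
    then have "v (c j \<otimes> xs j) = None"
      using value_mult_comm[OF cj xc[OF j(1)]] infinite_mult[OF xc[OF j(1)] cj] by simp
    then show False using j(2) one_finite by (cases "v \<one>") auto
  qed
  have "xs i \<in> span_over R A n xs"
  proof -
    define d where "d j = (if i = j then \<one> else \<zero>)" for j
    have "d \<in> {1..n} \<rightarrow> A" unfolding d_def using subringE(2,3)[OF A] by simp
    moreover have "(\<Oplus>j\<in>{1..n}. d j \<otimes> xs j) = (\<Oplus>j\<in>{1..n}. if i = j then xs j else \<zero>)"
      by (rule finsum_cong') (use xc in \<open>auto simp: d_def\<close>)
    moreover have "\<dots> = xs i"
      by (rule finsum_singleton) (use i xc in auto)
    ultimately show ?thesis unfolding span_over_def by force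
  qed
  then obtain r where r: "r \<in> {1..n} \<rightarrow> A" "s \<otimes> xs i = (\<Oplus>j\<in>{1..n}. r j \<otimes> xs j)"
    using stable unfolding span_over_def by blast
  have rc: "(\<lambda>j. r j \<otimes> xs j) \<in> {1..n} \<rightarrow> carrier R" using r(1) xc Ac by fast
  obtain j where j: "j \<in> {1..n}" "r j \<otimes> xs j \<preceq> s \<otimes> xs i"
    using some_term_below_finsum[OF _ ne rc] r(2) by auto
  have rj: "r j \<in> A" "r j \<in> carrier R" using r(1) j Ac by auto
  have "r j \<otimes> xs i \<preceq> r j \<otimes> xs j"
    using below_mult[OF xc[OF i(1)] xc[OF j(1)] rj(2)] i j
      value_mult_comm[OF xc[OF i(1)] rj(2)] value_mult_comm[OF xc[OF j(1)] rj(2)] by simp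
  then have "r j \<otimes> xs i \<preceq> s \<otimes> xs i" using j(2) below_trans by blast
  then have "r j \<preceq> s" by (rule below_cancel[OF rj(2) sc xc[OF i(1)] \<open>v (xs i) \<noteq> None\<close>])
  then show ?thesis using rj(1) by blast
qed

lemma integral_bound:
  assumes A: "subring A R" and int: "integral_over R A" and s: "s \<in> carrier R"
  shows "\<exists>r\<in>A. r \<preceq> s"
proof -
  have "s \<in> integral_closure R A" using int s unfolding integral_over_def by simp
  then obtain x y where xy: "s = x \<oplus> y" "x \<in> even_part R" "y \<in> odd_part R"
    "homogeneous_integral R A x" "homogeneous_integral R A y"
    unfolding integral_closure_def by blast
  have "x \<in> carrier R" "y \<in> carrier R"
    using xy(2,3) additive_subgroup.a_subset[OF even_subgroup]
      additive_subgroup.a_subset[OF odd_subgroup] by blast+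
  then have "x \<preceq> s \<or> y \<preceq> s" unfolding xy(1) by (rule some_summand_below_sum)
  moreover obtain a where a: "a \<in> A" "a \<preceq> x" using homogeneous_integral_bound[OF A xy(4)] by blast
  moreover obtain b where b: "b \<in> A" "b \<preceq> y" using homogeneous_integral_bound[OF A xy(5)] by blast
  ultimately show ?thesis using below_trans by blast
qed

lemma val_ring_iff: "x \<in> val_ring R G v \<longleftrightarrow> x \<in> carrier R \<and> \<one> \<preceq> x"
  by (simp add: val_ring_def val_of_one)

lemma val_ideal_iff: "x \<in> val_ideal R G v \<longleftrightarrow> x \<in> carrier R \<and> \<not> x \<preceq> \<one>"
proof (cases "x \<in> carrier R")
  case True
  have "val_less G (v \<one>) (v x) \<longleftrightarrow> \<one> \<preceq> x \<and> \<not> (\<one> \<preceq> x \<and> x \<preceq> \<one>)"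
    using value_eq_iff[OF one_closed, of x] by (simp add: val_less_def)
  then show ?thesis
    using below_linear[OF one_closed True] True by (auto simp: val_ideal_def val_of_one)
qed (simp add: val_ideal_def)

end

section \<open>Dominating valuations are extensions\<close>

text \<open>The last assumption is what integrality of \<open>S\<close> over \<open>R\<close> contributes, by \<open>integral_bound\<close>.\<close>

locale dominating_valuation =
  V: valuation "restrict_superring S R" G v + W: valuation S H w
  for S :: "'a superring" and R :: "'a set"
    and G :: "'g ordered_group" and v and H :: "'h ordered_group" and w +
  assumes subset: "R \<subseteq> carrier S"
    and dominated: "dominates (val_ring S H w, val_ideal S H w)
      (val_ring (restrict_superring S R) G v, val_ideal (restrict_superring S R) G v)"
    and cofinal: "s \<in> carrier S \<Longrightarrow> \<exists>r\<in>R. val_le H (w r) (w s)"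
begin

lemma mult_in: "\<lbrakk>x \<in> R; y \<in> R\<rbrakk> \<Longrightarrow> x \<otimes>\<^bsub>S\<^esub> y \<in> R"
  using V.m_closed by simp

lemma car: "x \<in> R \<Longrightarrow> x \<in> carrier S"
  using subset by blast

lemma nonneg_preserved: "\<lbrakk>x \<in> R; V.below \<one>\<^bsub>S\<^esub> x\<rbrakk> \<Longrightarrow> W.below \<one>\<^bsub>S\<^esub> x"
  using dominated V.val_ring_iff[of x] W.val_ring_iff[of x] unfolding dominates_def by auto

text \<open>The equation \<open>p\<^sub>v = A\<^sub>v \<inter> p\<^sub>w\<close> in terms of comparisons: \<open>x\<close> lies in the valuation ideal unless its value
is at most \<open>0\<close>.\<close>

lemma positive_iff:
  assumes x: "x \<in> R" "V.below \<one>\<^bsub>S\<^esub> x"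
  shows "V.below x \<one>\<^bsub>S\<^esub> \<longleftrightarrow> W.below x \<one>\<^bsub>S\<^esub>"
proof -
  have "x \<in> val_ideal (restrict_superring S R) G v \<longleftrightarrow>
      x \<in> val_ring (restrict_superring S R) G v \<inter> val_ideal S H w"
    using dominated unfolding dominates_def by simp
  then show ?thesis
    using x car[OF x(1)] V.val_ideal_iff[of x] W.val_ideal_iff[of x] V.val_ring_iff[of x] by auto
qed

lemma unit_preserved:
  assumes x: "x \<in> R" "v x = v \<one>\<^bsub>S\<^esub>"
  shows "w x = w \<one>\<^bsub>S\<^esub>"
proof -
  have "V.below \<one>\<^bsub>S\<^esub> x" "V.below x \<one>\<^bsub>S\<^esub>" using V.value_eq_iff[of x] x by auto
  then show ?thesis
    using x(1) car nonneg_preserved positive_iff W.value_eq_iff by blast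
qed

lemma inverse_in_subring:
  assumes x: "x \<in> R" "v x \<noteq> None"
  obtains y where "y \<in> R" "v (x \<otimes>\<^bsub>S\<^esub> y) = v \<one>\<^bsub>S\<^esub>" "w (x \<otimes>\<^bsub>S\<^esub> y) = w \<one>\<^bsub>S\<^esub>"
proof -
  obtain y where y: "y \<in> R" "v (x \<otimes>\<^bsub>S\<^esub> y) = v \<one>\<^bsub>S\<^esub>"
    using V.inverse_value_exists[of x] x by auto
  then show ?thesis using that unit_preserved[OF mult_in[OF x(1) y(1)]] by blast
qed

text \<open>Maximality of a valuation pair under domination. An element \<open>x\<close> with \<open>v x < 0\<close> has an inverse \<open>y\<close> up to a unit,
with \<open>v y > 0\<close>. Domination gives \<open>w y > 0\<close>, hence \<open>w x < 0\<close>.\<close>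

lemma nonneg_iff:
  assumes x: "x \<in> R"
  shows "V.below \<one>\<^bsub>S\<^esub> x \<longleftrightarrow> W.below \<one>\<^bsub>S\<^esub> x"
proof
  assume W1: "W.below \<one>\<^bsub>S\<^esub> x"
  show "V.below \<one>\<^bsub>S\<^esub> x"
  proof (rule ccontr)
    assume neg: "\<not> V.below \<one>\<^bsub>S\<^esub> x"
    then have fin: "v x \<noteq> None" by (cases "v x") auto
    obtain y where y: "y \<in> R" "v (x \<otimes>\<^bsub>S\<^esub> y) = v \<one>\<^bsub>S\<^esub>" "w (x \<otimes>\<^bsub>S\<^esub> y) = w \<one>\<^bsub>S\<^esub>"
      by (rule inverse_in_subring[OF x fin])
    have ny: "\<not> V.below y \<one>\<^bsub>S\<^esub>"
    proof
      assume "V.below y \<one>\<^bsub>S\<^esub>"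
      then have "V.below (y \<otimes>\<^bsub>S\<^esub> x) (\<one>\<^bsub>S\<^esub> \<otimes>\<^bsub>S\<^esub> x)"
        using V.below_mult[of y "\<one>\<^bsub>S\<^esub>" x] x y V.one_closed by simp
      then show False using neg V.value_mult_comm[of x y] x y car[OF x] by simp
    qed
    then have py: "V.below \<one>\<^bsub>S\<^esub> y" using V.below_linear[of y "\<one>\<^bsub>S\<^esub>"] y V.one_closed by auto
    have "W.below (\<one>\<^bsub>S\<^esub> \<otimes>\<^bsub>S\<^esub> y) (x \<otimes>\<^bsub>S\<^esub> y)"
      using W.below_mult[OF _ _ _ W1, of y] x y car by simp
    then have "W.below y \<one>\<^bsub>S\<^esub>" using y car by simp
    then show False using positive_iff[OF y(1) py] ny by simp
  qed
qed (rule nonneg_preserved[OF x])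

text \<open>The critical direction is from \<open>v x = \<infinity>\<close> to \<open>w x = \<infinity>\<close>. If \<open>w x\<close> were finite, it would be positive, and the values
of \<open>s x\<close> for \<open>s\<close> in \<open>S\<close> would all be at least \<open>0\<close> by cofinality. Surjectivity of
\<open>w\<close> provides \<open>s = y y\<close> with \<open>w y = - w x\<close>, for which \<open>w (s x) = - w x\<close> is negative.\<close>

lemma infinite_iff:
  assumes x: "x \<in> R"
  shows "v x = None \<longleftrightarrow> w x = None"
proof
  assume inf: "w x = None"
  show "v x = None"
  proof (rule ccontr)
    assume fin: "v x \<noteq> None"
    obtain y where y: "y \<in> R" "w (x \<otimes>\<^bsub>S\<^esub> y) = w \<one>\<^bsub>S\<^esub>"
      by (rule inverse_in_subring[OF x fin])
    then show False using W.infinite_mult[of x y] inf x car W.one_finite by simp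
  qed
next
  assume inf: "v x = None"
  show "w x = None"
  proof (rule ccontr)
    assume fin: "w x \<noteq> None"
    have xc: "x \<in> carrier S" using x car by blast
    have bound: "W.below \<one>\<^bsub>S\<^esub> (s \<otimes>\<^bsub>S\<^esub> x)" if s: "s \<in> carrier S" for s
    proof -
      obtain r where r: "r \<in> R" "W.below r s" using cofinal[OF s] by blast
      have "v (x \<otimes>\<^bsub>S\<^esub> r) = None" using V.infinite_mult[of x r] inf x r by simp
      then have "W.below \<one>\<^bsub>S\<^esub> (x \<otimes>\<^bsub>S\<^esub> r)"
        using nonneg_preserved[OF mult_in[OF x r(1)]] by simp
      then have "W.below \<one>\<^bsub>S\<^esub> (r \<otimes>\<^bsub>S\<^esub> x)"
        using W.value_mult_comm[OF xc car[OF r(1)]] by simp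
      moreover have "W.below (r \<otimes>\<^bsub>S\<^esub> x) (s \<otimes>\<^bsub>S\<^esub> x)"
        using W.below_mult[OF car[OF r(1)] s xc r(2)] .
      ultimately show ?thesis by (rule W.below_trans)
    qed
    obtain y where y: "y \<in> carrier S" "w (x \<otimes>\<^bsub>S\<^esub> y) = w \<one>\<^bsub>S\<^esub>"
      using W.inverse_value_exists[OF xc fin] by blast
    have yx: "w (y \<otimes>\<^bsub>S\<^esub> x) = w \<one>\<^bsub>S\<^esub>" using y W.value_mult_comm[OF xc y(1)] by simp
    have "W.below \<one>\<^bsub>S\<^esub> ((y \<otimes>\<^bsub>S\<^esub> y) \<otimes>\<^bsub>S\<^esub> x)" using bound y by simp
    then have "W.below \<one>\<^bsub>S\<^esub> (y \<otimes>\<^bsub>S\<^esub> (y \<otimes>\<^bsub>S\<^esub> x))" using y xc by (simp add: W.m_assoc)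
    moreover have "w (y \<otimes>\<^bsub>S\<^esub> (y \<otimes>\<^bsub>S\<^esub> x)) = w y"
      using W.val_of_mult[of y "y \<otimes>\<^bsub>S\<^esub> x"] W.val_of_mult[of y "\<one>\<^bsub>S\<^esub>"] y yx xc by simp
    ultimately have "W.below \<one>\<^bsub>S\<^esub> y" by simp
    then have "W.below (\<one>\<^bsub>S\<^esub> \<otimes>\<^bsub>S\<^esub> x) (y \<otimes>\<^bsub>S\<^esub> x)"
      using W.below_mult[of "\<one>\<^bsub>S\<^esub>" y x] y xc by simp
    then have "W.below x \<one>\<^bsub>S\<^esub>" using yx xc by simp
    moreover have "\<not> V.below x \<one>\<^bsub>S\<^esub>" using inf V.one_finite by (cases "v \<one>\<^bsub>S\<^esub>") auto
    ultimately show False using positive_iff[OF x] inf by simp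
  qed
qed

text \<open>If \<open>x\<close> has finite value, multiplying both sides by an inverse of \<open>x\<close> up to a unit reduces the comparison to one with the value \<open>0\<close>.\<close>

lemma comparison_agrees:
  assumes x: "x \<in> R" and y: "y \<in> R"
  shows "V.below x y \<longleftrightarrow> W.below x y"
proof (cases "v x = None")
  case True
  then have "V.below x y \<longleftrightarrow> v y = None" by (cases "v y") auto
  moreover have "w x = None" using True infinite_iff[OF x] by simp
  then have "W.below x y \<longleftrightarrow> w y = None" by (cases "w y") auto
  ultimately show ?thesis using infinite_iff[OF y] by simp
next
  case False
  obtain z where z: "z \<in> R" "v (x \<otimes>\<^bsub>S\<^esub> z) = v \<one>\<^bsub>S\<^esub>" "w (x \<otimes>\<^bsub>S\<^esub> z) = w \<one>\<^bsub>S\<^esub>"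
    by (rule inverse_in_subring[OF x False])
  have xc: "x \<in> carrier S" "y \<in> carrier S" "z \<in> carrier S" using x y z car by auto
  have vz: "v z \<noteq> None"
  proof
    assume "v z = None"
    then have "v (z \<otimes>\<^bsub>S\<^esub> x) = None" using V.infinite_mult[of z x] x z by simp
    then show False using V.value_mult_comm[of z x] V.one_finite x z by simp
  qed
  have wz: "w z \<noteq> None" using vz infinite_iff[OF z(1)] by simp
  have "V.below x y \<longleftrightarrow> V.below (x \<otimes>\<^bsub>S\<^esub> z) (y \<otimes>\<^bsub>S\<^esub> z)"
    using V.below_mult[of x y z] V.below_cancel[of x y z] x y z vz by auto
  also have "\<dots> \<longleftrightarrow> V.below \<one>\<^bsub>S\<^esub> (y \<otimes>\<^bsub>S\<^esub> z)" using z by simp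
  also have "\<dots> \<longleftrightarrow> W.below \<one>\<^bsub>S\<^esub> (y \<otimes>\<^bsub>S\<^esub> z)" by (rule nonneg_iff[OF mult_in[OF y z(1)]])
  also have "\<dots> \<longleftrightarrow> W.below (x \<otimes>\<^bsub>S\<^esub> z) (y \<otimes>\<^bsub>S\<^esub> z)" using z by simp
  also have "\<dots> \<longleftrightarrow> W.below x y"
    using W.below_mult[OF xc] W.below_cancel[OF xc wz] by blast
  finally show ?thesis .
qed

lemma extends: "extends_valuation S H w R G v"
proof -
  define h where "h g = the (w (SOME x. x \<in> R \<and> v x = Some g))" for g
  \<comment> \<open>The choice of \<open>x\<close> in \<open>h\<close> is immaterial, since elements of equal \<open>v\<close>-value have equal \<open>w\<close>-value.\<close>
  have w_h: "w x = Some (h g)" if x: "x \<in> R" "v x = Some g" for x g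
  proof -
    define y where "y = (SOME y. y \<in> R \<and> v y = Some g)"
    have y: "y \<in> R \<and> v y = Some g" unfolding y_def by (rule someI[of _ x]) (use x in simp)
    have "V.below x y" "V.below y x" using V.value_eq_iff[of x y] x y by auto
    then have "w x = w y"
      using comparison_agrees x y W.value_eq_iff[OF car[OF x(1)], of y] by blast
    moreover have "w x \<noteq> None" using infinite_iff[OF x(1)] x by simp
    ultimately show ?thesis unfolding h_def y_def by auto
  qed
  have lift: "\<exists>x\<in>R. v x = Some g" if g: "g \<in> carrier G" for g
  proof -
    have "Some g \<in> v ` R" using V.surjective g by simp
    then show ?thesis by (metis imageE)
  qed
  have h_closed: "h g \<in> carrier H" if g: "g \<in> carrier G" for g
  proof -
    obtain x where x: "x \<in> R" "v x = Some g" using lift[OF g] by blast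
    show ?thesis using W.surjective car[OF x(1)] w_h[OF x] by (metis W.value_cases option.inject option.distinct(1))
  qed
  have h_mult: "h (g \<otimes>\<^bsub>G\<^esub> g') = h g \<otimes>\<^bsub>H\<^esub> h g'" if g: "g \<in> carrier G" "g' \<in> carrier G" for g g'
  proof -
    obtain x where x: "x \<in> R" "v x = Some g" using lift[OF g(1)] by blast
    obtain x' where x': "x' \<in> R" "v x' = Some g'" using lift[OF g(2)] by blast
    have "v (x \<otimes>\<^bsub>S\<^esub> x') = Some (g \<otimes>\<^bsub>G\<^esub> g')" using V.val_of_mult[of x x'] x x' by simp
    then have "w (x \<otimes>\<^bsub>S\<^esub> x') = Some (h (g \<otimes>\<^bsub>G\<^esub> g'))" by (rule w_h[OF mult_in[OF x(1) x'(1)]])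
    moreover have "w (x \<otimes>\<^bsub>S\<^esub> x') = Some (h g \<otimes>\<^bsub>H\<^esub> h g')"
      using W.val_of_mult[OF car[OF x(1)] car[OF x'(1)]] w_h[OF x] w_h[OF x'] by simp
    ultimately show ?thesis by simp
  qed
  have h_order: "(g, g') \<in> ord_rel G \<longleftrightarrow> (h g, h g') \<in> ord_rel H"
    if g: "g \<in> carrier G" "g' \<in> carrier G" for g g'
  proof -
    obtain x where x: "x \<in> R" "v x = Some g" using lift[OF g(1)] by blast
    obtain x' where x': "x' \<in> R" "v x' = Some g'" using lift[OF g(2)] by blast
    show ?thesis using comparison_agrees[OF x(1) x'(1)] x x' w_h[OF x] w_h[OF x'] by simp
  qed
  have inj: "inj_on h (carrier G)"
  proof (rule inj_onI)
    fix g g' assume g: "g \<in> carrier G" "g' \<in> carrier G" and eq: "h g = h g'"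
    have "(h g, h g') \<in> ord_rel H" "(h g', h g) \<in> ord_rel H"
      using W.value_group.le_refl[OF h_closed[OF g(1)]] eq by auto
    then show "g = g'" using h_order g V.value_group.le_antisym by blast
  qed
  have "group_hom G H h"
    by (intro group_hom.intro group_hom_axioms.intro V.value_group.is_group W.value_group.is_group homI
        h_closed h_mult)
  then have "subgroup (h ` carrier G) H" by (rule group_hom.img_is_subgroup)
  moreover have "h \<in> iso G (H\<lparr>carrier := h ` carrier G\<rparr>)"
    unfolding iso_def using h_mult inj by (auto simp: hom_def bij_betw_def)
  ultimately have "order_iso_onto G H (h ` carrier G) h"
    unfolding order_iso_onto_def using h_order by blast
  moreover have "w x = map_option h (v x)" if x: "x \<in> R" for x
    using infinite_iff[OF x] w_h[OF x] by (cases "v x") auto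
  ultimately show ?thesis
    unfolding extends_valuation_def using V.valuation_axioms W.valuation_axioms by blast
qed

end

section \<open>Existence of dominating valuations\<close>

context superring
begin

lemma even_carrier: "x \<in> even_part R \<Longrightarrow> x \<in> carrier R"
  and odd_carrier: "x \<in> odd_part R \<Longrightarrow> x \<in> carrier R"
  using additive_subgroup.a_subset[OF even_subgroup] additive_subgroup.a_subset[OF odd_subgroup]
  by blast+

lemmas even_closed = additive_subgroup.zero_closed[OF even_subgroup]
  additive_subgroup.a_closed[OF even_subgroup] additive_subgroup.a_inv_closed[OF even_subgroup]

lemmas odd_closed = additive_subgroup.zero_closed[OF odd_subgroup]
  additive_subgroup.a_closed[OF odd_subgroup] additive_subgroup.a_inv_closed[OF odd_subgroup]

lemma homogeneous_decomposition:
  assumes "x \<in> carrier R"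
  obtains a b where "a \<in> even_part R" "b \<in> odd_part R" "x = a \<oplus> b"
  using assms unfolding grading_sum[symmetric] set_add_def' by blast

lemma even_component_unique:
  assumes a: "a \<in> even_part R" "a' \<in> even_part R" and b: "b \<in> odd_part R" "b' \<in> odd_part R"
    and eq: "a \<oplus> b = a' \<oplus> b'"
  shows "a = a'"
proof -
  have car: "a \<in> carrier R" "a' \<in> carrier R" "b \<in> carrier R" "b' \<in> carrier R"
    using a b even_carrier odd_carrier by auto
  have "\<ominus> a' \<oplus> a = \<ominus> a' \<oplus> (a \<oplus> b) \<oplus> \<ominus> b" using car by (simp add: a_assoc r_neg)
  also have "\<dots> = b' \<oplus> \<ominus> b" unfolding eq using car by (simp add: a_assoc[symmetric] l_neg)
  finally have "\<ominus> a' \<oplus> a = b' \<oplus> \<ominus> b" .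
  moreover have "\<ominus> a' \<oplus> a \<in> even_part R" "b' \<oplus> \<ominus> b \<in> odd_part R"
    using a b by (auto intro: even_closed odd_closed)
  ultimately have "\<ominus> a' \<oplus> a \<in> even_part R \<inter> odd_part R" by simp
  then have "\<ominus> a' \<oplus> a = \<zero>" unfolding grading_direct by simp
  then have "\<ominus> (\<ominus> a') = a" using car by (intro minus_equality) (simp_all add: a_comm)
  then show ?thesis using car by simp
qed

definition even_component :: "'a \<Rightarrow> 'a" where
  "even_component x = (THE a. a \<in> even_part R \<and> (\<exists>b\<in>odd_part R. x = a \<oplus> b))"

lemma even_component_eq:
  assumes "a \<in> even_part R" "b \<in> odd_part R"
  shows "even_component (a \<oplus> b) = a"
  unfolding even_component_def
proof (rule the_equality)
  show "a \<in> even_part R \<and> (\<exists>b'\<in>odd_part R. a \<oplus> b = a \<oplus> b')" using assms by blast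
  show "a' = a" if "a' \<in> even_part R \<and> (\<exists>b'\<in>odd_part R. a \<oplus> b = a' \<oplus> b')" for a'
    using that assms even_component_unique[of a' a _ b] by auto
qed

lemma even_component_even:
  assumes "a \<in> even_part R" shows "even_component a = a"
  using even_component_eq[OF assms odd_closed(1)] even_carrier[OF assms] by simp

lemma even_component_closed:
  assumes "x \<in> carrier R" shows "even_component x \<in> even_part R"
  using assms by (rule homogeneous_decomposition) (simp add: even_component_eq)

lemma even_component_add:
  assumes x: "x \<in> carrier R" and y: "y \<in> carrier R"
  shows "even_component (x \<oplus> y) = even_component x \<oplus> even_component y"
proof -
  obtain a b where ab: "a \<in> even_part R" "b \<in> odd_part R" "x = a \<oplus> b"
    using x by (rule homogeneous_decomposition)
  obtain c d where cd: "c \<in> even_part R" "d \<in> odd_part R" "y = c \<oplus> d"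
    using y by (rule homogeneous_decomposition)
  have "x \<oplus> y = (a \<oplus> c) \<oplus> (b \<oplus> d)"
    unfolding ab(3) cd(3) using ab cd even_carrier odd_carrier by (simp add: a_ac)
  then show ?thesis
    using ab cd even_closed(2) odd_closed(2) by (simp add: even_component_eq)
qed

lemma odd_anticommute:
  assumes b: "b \<in> odd_part R" and d: "d \<in> odd_part R"
  shows "b \<otimes> d = \<ominus> (d \<otimes> b)"
proof -
  have car: "b \<in> carrier R" "d \<in> carrier R" using b d odd_carrier by auto
  have "(b \<oplus> d) \<otimes> (b \<oplus> d) = \<zero>" using odd_square[OF odd_closed(2)[OF b d]] .
  then have "b \<otimes> b \<oplus> b \<otimes> d \<oplus> (d \<otimes> b \<oplus> d \<otimes> d) = \<zero>"
    using car by (simp add: l_distr r_distr a_ac)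
  then have "b \<otimes> d \<oplus> d \<otimes> b = \<zero>" using odd_square b d car by simp
  then show ?thesis using car by (intro minus_equality[symmetric]) simp_all
qed

lemma odd_mult_square_zero:
  assumes b: "b \<in> odd_part R" and d: "d \<in> odd_part R"
  shows "(b \<otimes> d) \<otimes> (b \<otimes> d) = \<zero>"
proof -
  have car: "b \<in> carrier R" "d \<in> carrier R" using b d odd_carrier by auto
  have "(b \<otimes> d) \<otimes> (b \<otimes> d) = b \<otimes> (d \<otimes> b) \<otimes> d" using car by (simp add: m_assoc)
  also have "\<dots> = \<ominus> ((b \<otimes> b) \<otimes> (d \<otimes> d))"
    unfolding odd_anticommute[OF d b] using car by (simp add: m_assoc l_minus r_minus)
  finally show ?thesis using odd_square b d car by simp
qed

text \<open>The even component is multiplicative only up to a product \<open>n\<close> of two odd elements. Since \<open>n\<close> has square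
zero, it does not affect values.\<close>

lemma even_component_mult:
  assumes x: "x \<in> carrier R" and y: "y \<in> carrier R"
  shows "\<exists>n\<in>even_part R. n \<otimes> n = \<zero> \<and>
    even_component (x \<otimes> y) = even_component x \<otimes> even_component y \<oplus> n"
proof -
  obtain a b where ab: "a \<in> even_part R" "b \<in> odd_part R" "x = a \<oplus> b"
    using x by (rule homogeneous_decomposition)
  obtain c d where cd: "c \<in> even_part R" "d \<in> odd_part R" "y = c \<oplus> d"
    using y by (rule homogeneous_decomposition)
  have car: "a \<in> carrier R" "b \<in> carrier R" "c \<in> carrier R" "d \<in> carrier R"
    using ab cd even_carrier odd_carrier by auto
  have "x \<otimes> y = (a \<otimes> c \<oplus> b \<otimes> d) \<oplus> (a \<otimes> d \<oplus> b \<otimes> c)"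
    unfolding ab(3) cd(3) using car by (simp add: l_distr r_distr a_ac)
  moreover have "a \<otimes> c \<oplus> b \<otimes> d \<in> even_part R"
    using ab cd by (intro even_closed(2) even_even odd_odd)
  moreover have "a \<otimes> d \<oplus> b \<otimes> c \<in> odd_part R"
    using ab cd by (intro odd_closed(2) even_odd odd_even)
  ultimately have "even_component (x \<otimes> y) = a \<otimes> c \<oplus> b \<otimes> d"
    using even_component_eq by simp
  then have "even_component (x \<otimes> y) = even_component x \<otimes> even_component y \<oplus> b \<otimes> d"
    using ab cd by (simp add: even_component_eq)
  then show ?thesis using odd_odd[OF ab(2) cd(2)] odd_mult_square_zero[OF ab(2) cd(2)] by blast
qed

text \<open>Write \<open>1 = a + b\<close> with \<open>a\<close> even and \<open>b\<close> odd. Comparing even parts in \<open>a = a (a + b)\<close> shows \<open>a b = 0\<close>,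
and then \<open>b = (a + b) b = a b + b b = 0\<close>.\<close>

lemma one_even: "\<one> \<in> even_part R"
proof -
  obtain a b where ab: "a \<in> even_part R" "b \<in> odd_part R" "\<one> = a \<oplus> b"
    using one_closed by (rule homogeneous_decomposition)
  have car: "a \<in> carrier R" "b \<in> carrier R" using ab even_carrier odd_carrier by auto
  have "a \<oplus> \<zero> = a \<otimes> (a \<oplus> b)" using car ab(3)[symmetric] by simp
  also have "\<dots> = a \<otimes> a \<oplus> a \<otimes> b" using car by (simp add: r_distr)
  finally have eq: "a \<oplus> \<zero> = a \<otimes> a \<oplus> a \<otimes> b" .
  have "a = a \<otimes> a"
    by (rule even_component_unique[OF ab(1) even_even[OF ab(1,1)] odd_closed(1) even_odd[OF ab(1,2)] eq])
  then have "a \<oplus> a \<otimes> b = a \<oplus> \<zero>" using eq car by simp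
  then have "a \<otimes> b = \<zero>" using car by simp
  moreover have "b = (a \<oplus> b) \<otimes> b" using car ab(3)[symmetric] by simp
  then have "b = a \<otimes> b \<oplus> b \<otimes> b" using car by (simp add: l_distr)
  ultimately have "b = \<zero>" using odd_square[OF ab(2)] by simp
  then show ?thesis using ab car by simp
qed

lemma even_part_cring: "cring (R\<lparr>carrier := even_part R\<rparr>)"
proof -
  have "subring (even_part R) R"
    using even_carrier one_even even_closed even_even by (intro subringI) auto
  then have "subcring (even_part R) R"
    using even_central even_carrier by (intro subcringI) auto
  then show ?thesis using subcring_iff[of "even_part R"] even_carrier by blast
qed

end

text \<open>A pair in the even part gives a valuation on the whole superring that ignores odd components.\<close>

lemma (in superring) valuation_of_manis_pair:
  assumes "manis_pair (R\<lparr>carrier := even_part R\<rparr>) B q"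
  shows "\<exists>(H :: 'a set ordered_group) w. valuation R H w \<and>
    (\<forall>x\<in>carrier R. (x \<in> val_ring R H w \<longleftrightarrow> even_component x \<in> B) \<and>
      (x \<in> val_ideal R H w \<longleftrightarrow> even_component x \<in> q))"
proof -
  interpret M: manis_pair "R\<lparr>carrier := even_part R\<rparr>" B q by (rule assms)
  define w where "w x = M.value_of (even_component x)" for x
  have "valuation R M.value_group w"
  proof (intro valuation.intro valuation_axioms.intro superring_axioms M.value_group_ordered)
    have "even_component ` carrier R = even_part R"
    proof
      show "even_component ` carrier R \<subseteq> even_part R" using even_component_closed by blast
      show "even_part R \<subseteq> even_component ` carrier R"
        using even_component_even even_carrier by (metis image_iff subsetI)
    qed
    then have "w ` carrier R = M.value_of ` even_part R"
      unfolding w_def by (metis image_image)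
    then show "w ` carrier R = insert None (Some ` carrier M.value_group)"
      using M.value_of_image by simp
    show "w \<zero> = None"
      using M.transporter_zero even_component_even[OF even_closed(1)]
      by (simp add: w_def M.value_of_def)
    show "w \<one> = val_zero M.value_group"
      using M.value_of_one even_component_even[OF one_even] by (simp add: w_def)
  next
    fix x y assume x: "x \<in> carrier R" and y: "y \<in> carrier R"
    note ex = even_component_closed[OF x] and ey = even_component_closed[OF y]
    obtain n where n: "n \<in> even_part R" "n \<otimes> n = \<zero>"
      and xy: "even_component (x \<otimes> y) = even_component x \<otimes> even_component y \<oplus> n"
      using even_component_mult[OF x y] by blast
    have "M.transporter n = even_part R" using M.transporter_square_zero[of n] n by simp
    then have "M.transporter (even_component (x \<otimes> y)) =
        M.transporter (even_component x \<otimes> even_component y)"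
      unfolding xy
      using M.transporter_add_infinite[of "even_component x \<otimes> even_component y" n]
        even_even[OF ex ey] n by simp
    then have "w (x \<otimes> y) = M.value_of (even_component x \<otimes> even_component y)"
      unfolding w_def M.value_of_def by simp
    then show "w (x \<otimes> y) = val_add M.value_group (w x) (w y)"
      using M.value_of_mult[of "even_component x" "even_component y"] ex ey by (simp add: w_def)
    show "val_le M.value_group (val_min M.value_group (w x) (w y)) (w (x \<oplus> y))"
      using M.value_of_add[of "even_component x" "even_component y"] ex ey
        even_component_add[OF x y] by (simp add: w_def)
  qed
  moreover have "x \<in> val_ring R M.value_group w \<longleftrightarrow> even_component x \<in> B"
    "x \<in> val_ideal R M.value_group w \<longleftrightarrow> even_component x \<in> q" if x: "x \<in> carrier R" for x
    using M.value_of_nonneg_iff[of "even_component x"] M.value_of_pos_iff[of "even_component x"]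
      even_component_closed[OF x] x by (auto simp: val_ring_def val_ideal_def w_def)
  ultimately show ?thesis by blast
qed

lemma (in valuation) odd_infinite:
  assumes x: "x \<in> odd_part R" shows "v x = None"
proof -
  have "val_add G (v x) (v x) = None"
    using val_of_mult[of x x] odd_square[OF x] odd_carrier[OF x] val_of_zero by simp
  then show ?thesis by (cases "v x") auto
qed

lemma (in valuation) value_add_infinite:
  assumes x: "x \<in> carrier R" and y: "y \<in> carrier R" "v y = None"
  shows "v (x \<oplus> y) = v x"
proof -
  have inf: "v (y \<otimes> \<ominus> \<one>) = None" using infinite_mult[of y "\<ominus> \<one>"] y by simp
  have "x \<preceq> x \<oplus> y" using below_add[OF x y(1) below_refl[OF x]] y(2) by simp
  moreover have "x \<oplus> y \<preceq> x \<oplus> y \<oplus> y \<otimes> \<ominus> \<one>"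
    using below_add[of "x \<oplus> y" "y \<otimes> \<ominus> \<one>" "x \<oplus> y"] below_refl[of "x \<oplus> y"] x y inf by simp
  moreover have "x \<oplus> y \<oplus> y \<otimes> \<ominus> \<one> = x"
    using x y by (simp add: a_assoc r_minus r_neg)
  ultimately show ?thesis using value_eq_iff[of "x \<oplus> y" x] x y by simp
qed

lemma (in valuation) value_even_component:
  assumes x: "x \<in> carrier R" shows "v (even_component x) = v x"
proof -
  obtain a b where ab: "a \<in> even_part R" "b \<in> odd_part R" "x = a \<oplus> b"
    using x by (rule homogeneous_decomposition)
  then show ?thesis
    using value_add_infinite[OF even_carrier[OF ab(1)] odd_carrier[OF ab(2)] odd_infinite[OF ab(2)]]
    by (simp add: even_component_eq)
qed

text \<open>Restricting the pair of \<open>v\<close> to even elements loses nothing, because an element and its even component have the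
same value. Domination is therefore a statement about even elements only.\<close>

theorem dominating_valuation_exists:
  fixes S :: "'a superring"
  assumes S: "superring S" and R: "subsuperring R S"
    and v: "valuation (restrict_superring S R) G v"
  shows "\<exists>(H :: 'a set ordered_group) w. valuation S H w \<and>
    dominates (val_ring S H w, val_ideal S H w)
      (val_ring (restrict_superring S R) G v, val_ideal (restrict_superring S R) G v)"
proof -
  interpret S: superring S by (rule S)
  interpret V: valuation "restrict_superring S R" G v by (rule v)
  let ?C = "S\<lparr>carrier := even_part S\<rparr>"
  interpret C: cring ?C by (rule S.even_part_cring)
  have sub: "subring R S" using R unfolding subsuperring_def by blast
  note RE = subringE[OF sub]
  \<comment> \<open>The pair of \<open>v\<close> on even elements; the complement \<open>A - p\<close> consists of those of value \<open>0\<close>.\<close>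
  define A where "A = {x \<in> R \<inter> even_part S. V.below \<one>\<^bsub>S\<^esub> x}"
  define p where "p = {x \<in> R \<inter> even_part S. \<not> V.below x \<one>\<^bsub>S\<^esub>}"
  have minus_one: "V.below \<one>\<^bsub>S\<^esub> (\<ominus>\<^bsub>S\<^esub> \<one>\<^bsub>S\<^esub>)"
  proof (rule ccontr)
    let ?m = "\<ominus>\<^bsub>S\<^esub> \<one>\<^bsub>S\<^esub>"
    have m: "?m \<in> R" "?m \<otimes>\<^bsub>S\<^esub> ?m = \<one>\<^bsub>S\<^esub>" using RE(3,5) by (auto simp: S.l_minus)
    assume neg: "\<not> V.below \<one>\<^bsub>S\<^esub> ?m"
    then have "V.below ?m \<one>\<^bsub>S\<^esub>" using V.below_linear[of ?m "\<one>\<^bsub>S\<^esub>"] m RE(3) by auto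
    then have "V.below (?m \<otimes>\<^bsub>S\<^esub> ?m) (\<one>\<^bsub>S\<^esub> \<otimes>\<^bsub>S\<^esub> ?m)"
      using V.below_mult[of ?m "\<one>\<^bsub>S\<^esub>" ?m] m RE(3) by simp
    then show False using neg m by simp
  qed
  have mult_ge: "V.below b (a \<otimes>\<^bsub>S\<^esub> b)" if "a \<in> R" "b \<in> R" "V.below \<one>\<^bsub>S\<^esub> a" for a b
    using V.below_mult[of "\<one>\<^bsub>S\<^esub>" a b] that RE(1,3) by (simp add: subset_iff)
  have mult_le: "V.below (a \<otimes>\<^bsub>S\<^esub> b) b" if "a \<in> R" "b \<in> R" "V.below a \<one>\<^bsub>S\<^esub>" for a b
    using V.below_mult[of a "\<one>\<^bsub>S\<^esub>" b] that RE(1,3) by (simp add: subset_iff)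
  have pA: "p \<subseteq> A"
    unfolding p_def A_def using V.below_linear RE(3) by auto
  have A_mult: "a \<otimes>\<^bsub>S\<^esub> b \<in> A" if a: "a \<in> A" and b: "b \<in> A" for a b
  proof -
    have "V.below b (a \<otimes>\<^bsub>S\<^esub> b)" using mult_ge a b unfolding A_def by blast
    then have "V.below \<one>\<^bsub>S\<^esub> (a \<otimes>\<^bsub>S\<^esub> b)" using b V.below_trans unfolding A_def by blast
    then show ?thesis using a b RE(6) S.even_even unfolding A_def by auto
  qed
  have A_subring: "subring A ?C"
  proof (rule C.subringI)
    show "A \<subseteq> carrier ?C" unfolding A_def by auto
    show "\<one>\<^bsub>?C\<^esub> \<in> A" unfolding A_def using V.below_refl[of "\<one>\<^bsub>S\<^esub>"] RE(3) S.one_even by simp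
    then have one: "\<one>\<^bsub>S\<^esub> \<in> A" by simp
    fix a assume a: "a \<in> A"
    have ac: "a \<in> even_part S" "a \<in> carrier S" using a S.even_carrier unfolding A_def by auto
    have m: "\<ominus>\<^bsub>S\<^esub> \<one>\<^bsub>S\<^esub> \<in> A"
      using minus_one RE(3,5) S.one_even S.even_closed(3) unfolding A_def by simp
    have "\<ominus>\<^bsub>?C\<^esub> a = \<ominus>\<^bsub>S\<^esub> a"
      by (rule C.minus_equality) (use ac S.even_closed(3) S.l_neg in auto)
    moreover have "\<ominus>\<^bsub>S\<^esub> \<one>\<^bsub>S\<^esub> \<otimes>\<^bsub>S\<^esub> a = \<ominus>\<^bsub>S\<^esub> a" using ac by (simp add: S.l_minus)
    ultimately show "\<ominus>\<^bsub>?C\<^esub> a \<in> A" using A_mult[OF m a] by simp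
    fix b assume b: "b \<in> A"
    show "a \<otimes>\<^bsub>?C\<^esub> b \<in> A" using A_mult[OF a b] by simp
    have "V.below \<one>\<^bsub>S\<^esub> (a \<oplus>\<^bsub>S\<^esub> b)"
      using V.below_add[of a b "\<one>\<^bsub>S\<^esub>"] a b unfolding A_def by simp
    then show "a \<oplus>\<^bsub>?C\<^esub> b \<in> A"
      using a b RE(7) S.even_closed(2) unfolding A_def by simp
  qed
  have p_scale: "a \<otimes>\<^bsub>S\<^esub> b \<in> p" if a: "a \<in> A" and b: "b \<in> p" for a b
  proof -
    have "V.below b (a \<otimes>\<^bsub>S\<^esub> b)" using mult_ge a b unfolding A_def p_def by blast
    then have "\<not> V.below (a \<otimes>\<^bsub>S\<^esub> b) \<one>\<^bsub>S\<^esub>" using b V.below_trans unfolding p_def by blast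
    then show ?thesis using a b RE(6) S.even_even unfolding A_def p_def by auto
  qed
  have p_add: "a \<oplus>\<^bsub>S\<^esub> b \<in> p" if a: "a \<in> p" and b: "b \<in> p" for a b
  proof -
    have "V.below a (a \<oplus>\<^bsub>S\<^esub> b) \<or> V.below b (a \<oplus>\<^bsub>S\<^esub> b)"
      using V.some_summand_below_sum[of a b] a b unfolding p_def by simp
    then have "\<not> V.below (a \<oplus>\<^bsub>S\<^esub> b) \<one>\<^bsub>S\<^esub>" using a b V.below_trans unfolding p_def by blast
    then show ?thesis using a b RE(7) S.even_closed(2) unfolding p_def by simp
  qed
  have "\<zero>\<^bsub>S\<^esub> \<in> p"
    unfolding p_def using RE(2) S.even_closed(1) V.val_of_zero V.one_finite
    by (cases "v \<one>\<^bsub>S\<^esub>") auto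
  moreover have "p \<subseteq> even_part S" unfolding p_def by blast
  ultimately have p_closed: "C.closed_over A p"
    unfolding C.closed_over_def using p_add p_scale pA by (simp add: subset_iff)
  have T_mult: "s \<otimes>\<^bsub>S\<^esub> t \<in> A - p" if s: "s \<in> A - p" and t: "t \<in> A - p" for s t
  proof -
    have "V.below (s \<otimes>\<^bsub>S\<^esub> t) t" using mult_le s t unfolding A_def p_def by blast
    then have "V.below (s \<otimes>\<^bsub>S\<^esub> t) \<one>\<^bsub>S\<^esub>" using t V.below_trans unfolding A_def p_def by blast
    then show ?thesis using A_mult s t unfolding p_def by blast
  qed
  have T_one: "\<one>\<^bsub>S\<^esub> \<in> A - p"
    unfolding A_def p_def using V.below_refl[of "\<one>\<^bsub>S\<^esub>"] RE(3) S.one_even by simp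
  obtain B q where M: "manis_pair ?C B q" and AB: "A \<subseteq> B" "p \<subseteq> q" "q \<inter> (A - p) = {}"
  proof (rule C.manis_pair_exists[OF A_subring, of "A - p" p])
    show "\<one>\<^bsub>?C\<^esub> \<in> A - p" using T_one by simp
    show "s \<otimes>\<^bsub>?C\<^esub> t \<in> A - p" if "s \<in> A - p" "t \<in> A - p" for s t using T_mult[OF that] by simp
  qed (use p_closed in auto)
  obtain H :: "'a set ordered_group" and w where w: "valuation S H w"
    and w_iff: "\<And>x. x \<in> carrier S \<Longrightarrow> x \<in> val_ring S H w \<longleftrightarrow> S.even_component x \<in> B"
      "\<And>x. x \<in> carrier S \<Longrightarrow> x \<in> val_ideal S H w \<longleftrightarrow> S.even_component x \<in> q"
    using S.valuation_of_manis_pair[OF M] by blast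
  have comp: "S.even_component x \<in> R \<inter> even_part S" "v (S.even_component x) = v x"
    if x: "x \<in> R" for x
  proof -
    obtain a b where ab: "a \<in> R \<inter> even_part S" "b \<in> R \<inter> odd_part S" "x = a \<oplus>\<^bsub>S\<^esub> b"
      using V.homogeneous_decomposition[of x] x by auto
    have "S.even_component x = a" unfolding ab(3) using ab S.even_component_eq by simp
    moreover have "V.even_component x = a"
      unfolding ab(3) using ab V.even_component_eq[of a b] by simp
    ultimately show "S.even_component x \<in> R \<inter> even_part S" "v (S.even_component x) = v x"
      using ab V.value_even_component[of x] x by auto
  qed
  have ring_iff: "x \<in> val_ring (restrict_superring S R) G v \<longleftrightarrow> x \<in> R \<and> S.even_component x \<in> A" for x
    using comp[of x] V.val_ring_iff[of x] unfolding A_def by auto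
  have ideal_iff: "x \<in> val_ideal (restrict_superring S R) G v \<longleftrightarrow> x \<in> R \<and> S.even_component x \<in> p" for x
    using comp[of x] V.val_ideal_iff[of x] unfolding p_def by auto
  have "dominates (val_ring S H w, val_ideal S H w)
      (val_ring (restrict_superring S R) G v, val_ideal (restrict_superring S R) G v)"
    unfolding dominates_def fst_conv snd_conv
  proof (intro conjI subset_antisym subsetI IntI)
    fix x
    show "x \<in> val_ring S H w" if "x \<in> val_ring (restrict_superring S R) G v"
      using that ring_iff[of x] w_iff(1)[of x] AB(1) RE(1) by blast
    show "x \<in> val_ring (restrict_superring S R) G v"
      if "x \<in> val_ideal (restrict_superring S R) G v"
      using that ring_iff[of x] ideal_iff[of x] pA by blast
    show "x \<in> val_ideal S H w" if "x \<in> val_ideal (restrict_superring S R) G v"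
      using that ideal_iff[of x] w_iff(2)[of x] AB(2) RE(1) by blast
    show "x \<in> val_ideal (restrict_superring S R) G v"
      if "x \<in> val_ring (restrict_superring S R) G v \<inter> val_ideal S H w"
      using that ring_iff[of x] ideal_iff[of x] w_iff(2)[of x] AB(3) RE(1) by blast
  qed
  then show ?thesis using w by blast
qed

theorem dominating_valuation_extends:
  assumes R: "subsuperring R S" and v: "valuation (restrict_superring S R) G v"
    and int: "integral_over S R" and w: "valuation S H w"
    and dom: "dominates (val_ring S H w, val_ideal S H w)
      (val_ring (restrict_superring S R) G v, val_ideal (restrict_superring S R) G v)"
  shows "extends_valuation S H w R G v"
proof -
  have sub: "subring R S" using R unfolding subsuperring_def by blast
  have "dominating_valuation S R G v H w"
    by (intro dominating_valuation.intro dominating_valuation_axioms.intro v w dom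
        subringE(1)[OF sub] valuation.integral_bound[OF w sub int])
  then show ?thesis by (rule dominating_valuation.extends)
qed

theorem proposition3p13:
  fixes S :: "'a superring" and R :: "'a set"
    and G :: "'g ordered_group" and v :: "'a \<Rightarrow> 'g option"
  assumes "superring S" and "subsuperring R S"
    and "valuation (restrict_superring S R) G v"
    and "integral_over S R"
  shows "(\<forall>(H :: 'h ordered_group) w.
            valuation S H w \<and>
            dominates (val_ring S H w, val_ideal S H w)
              (val_ring (restrict_superring S R) G v, val_ideal (restrict_superring S R) G v)
            \<longrightarrow> extends_valuation S H w R G v) \<and>
         (\<exists>(H :: 'a set ordered_group) w. extends_valuation S H w R G v)"
proof
  show "\<forall>(H :: 'h ordered_group) w. valuation S H w \<and>
      dominates (val_ring S H w, val_ideal S H w)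
        (val_ring (restrict_superring S R) G v, val_ideal (restrict_superring S R) G v)
      \<longrightarrow> extends_valuation S H w R G v"
    using dominating_valuation_extends[OF assms(2-4)] by blast
  show "\<exists>(H :: 'a set ordered_group) w. extends_valuation S H w R G v"
    using dominating_valuation_exists[OF assms(1-3)] dominating_valuation_extends[OF assms(2-4)]
    by blast
qed

end
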